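(* Let $\mathfrak{A}$ be a $C^*$-algebra, let $H$ and $K$ be Hilbert $\mathfrak{A}$-modules, and let $M$ and $N$ be orthogonally complemented closed submodules of $H$ and $K$, respectively. Suppose that $T\in\mathcal{L}(H,K)$ is $(M,N)$-complementable. Then $$\mathcal{R}\big(T_{/(M,N)}\big)=\mathcal{R}(T)\cap N,\quad \mathcal{N}\big(T_{/(M,N)}\big)=M^\perp+\mathcal{N}(T).$$
   Context: For Hilbert $\mathfrak{A}$-modules $H,K$, $\mathcal{L}(H,K)$ denotes the set of adjointable operators from $H$ to $K$, $\mathcal{L}(H)=\mathcal{L}(H,H)$. $\mathcal{R}(\cdot)$ and $\mathcal{N}(\cdot)$ denote range and null space, the bar norm closure, $|T|=(T^*T)^{1/2}$; $+$ between submodules is the algebraic sum. A closed submodule $M\subseteq H$ is orthogonally complemented if $H=M+M^\perp$; $P_M$ is then the projection onto $M$. $U_{P_M}:H\to M\oplus M^\perp$ is the unitary $h\mapsto (P_Mh,(I_H-P_M)h)^T$, and $U_{P_N}:K\to N\oplus N^\perp$ is defined likewise. $T\in\mathcal{L}(H,K)$ is $(M,N)$-complementable if there exist $M_r\in\mathcal{L}(H)$ and $M_l\in\mathcal{L}(K)$ such that $(I_H-P_M)M_r=M_r$, $M_l(I_K-P_N)=M_l$, $(I_K-P_N)TM_r=(I_K-P_N)T$ and $M_lT(I_H-P_M)=T(I_H-P_M)$. Reduced solution: for $A\in\mathcal{L}(H_1,K_1)$, $C\in\mathcal{L}(E_1,K_1)$, an operator $D\in\mathcal{L}(E_1,H_1)$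 is the reduced solution of $AX=C$, $X\in\mathcal{L}(E_1,H_1)$, if $AD=C$ and $\mathcal{R}(D)\subseteq\overline{\mathcal{R}(A^* )}$ (unique if it exists). For every $R\in\mathcal{L}(H_1,K_1)$ the system $|R^*|^{1/2}X=R$, $X\in\mathcal{L}(H_1,K_1)$, has a reduced solution, denoted $V_R$. Blocks of $T\in\mathcal{L}(H,K)$: with $P_{M^\perp}=I_H-P_M$, $P_{N^\perp}=I_K-P_N$, $T_{11}=P_NTP_M|_M\in\mathcal{L}(M,N)$, $T_{12}=P_NTP_{M^\perp}|_{M^\perp}\in\mathcal{L}(M^\perp,N)$, $T_{21}=P_{N^\perp}TP_M|_M\in\mathcal{L}(M,N^\perp)$, $T_{22}=P_{N^\perp}TP_{M^\perp}|_{M^\perp}\in\mathcal{L}(M^\perp,N^\perp)$. $T$ is $(M,N)$-weakly complementable if all four systems $V_{T_{22}}Y_1=T_{21}$ ($Y_1\in\mathcal{L}(M,M^\perp)$), $|T_{22}|^{1/2}Y_2=T_{12}^*$ ($Y_2\in\mathcal{L}(N,M^\perp)$), $|T_{22}^*|^{1/2}Z_1=T_{21}$ ($Z_1\in\mathcal{L}(M,N^\perp)$), $V_{T_{22}}^*Z_2=T_{12}^*$ ($Z_2\in\mathcal{L}(N,N^\perp)$) have reduced solutions, denoted $E,F,\widetilde{E},\widetilde{F}$ respectively. In that case the bilateral shorted operator of $T$ with respect to $(M,N)$ is $$T_{/(M,N)}=U_{P_N}^*\begin{pmatrix}T_{11}-\frac12\big[F^*E+\widetilde{F}^*\widetilde{E}\big]&0\\0&0\end{pmatrix}U_{P_M}\in\mathcal{L}(H,K).$$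 Every $(M,N)$-complementable operator is $(M,N)$-weakly complementable, so $T_{/(M,N)}$ is defined for it. *)

theory Defs
  imports "HOL-Analysis.Analysis" "HOL-Library.FuncSet"
begin

class scaleC =
  fixes scaleC :: "complex \<Rightarrow> 'a \<Rightarrow> 'a" (infixr "*\<^sub>C" 75)

class complex_normed_vector = real_normed_vector + scaleC +
  assumes scaleC_add_right: "c *\<^sub>C (x + y) = c *\<^sub>C x + c *\<^sub>C y"
    and scaleC_add_left: "(c + d) *\<^sub>C x = c *\<^sub>C x + d *\<^sub>C x"
    and scaleC_scaleC: "c *\<^sub>C d *\<^sub>C x = (c * d) *\<^sub>C x"
    and scaleR_scaleC: "r *\<^sub>R x = complex_of_real r *\<^sub>C x"
    and norm_scaleC: "norm (c *\<^sub>C x) = cmod c * norm x"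

text \<open>No unit is required, and the zero algebra is allowed.\<close>

class cstar_algebra = complex_normed_vector + real_normed_algebra + banach +
  fixes star :: "'a \<Rightarrow> 'a"
  assumes mult_scaleC_left: "(c *\<^sub>C a) * b = c *\<^sub>C (a * b)"
    and mult_scaleC_right: "a * (c *\<^sub>C b) = c *\<^sub>C (a * b)"
    and star_star: "star (star a) = a"
    and star_add: "star (a + b) = star a + star b"
    and star_scaleC: "star (c *\<^sub>C a) = cnj c *\<^sub>C star a"
    and star_mult: "star (a * b) = star b * star a"
    and cstar_identity: "norm (star a * a) = (norm a)\<^sup>2"

definition cstar_positive :: "'a::cstar_algebra \<Rightarrow> bool" where
  "cstar_positive a \<longleftrightarrow> (\<exists>b. a = star b * b)"

text \<open>
  A Hilbert module is a carrier inside an ambient type, with an algebra-valued inner product and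
  a right action of the algebra. Explicit carriers let complemented submodules of a Hilbert module
  be Hilbert modules in their own right. The vector space operations and the norm are those of
  the ambient type.
\<close>

record ('a, 'h) hmod =
  carr :: "'h set"
  ip :: "'h \<Rightarrow> 'h \<Rightarrow> 'a"
  act :: "'h \<Rightarrow> 'a \<Rightarrow> 'h"

definition submodule :: "('a::cstar_algebra, 'h::complex_normed_vector) hmod \<Rightarrow> 'h set \<Rightarrow> bool" where
  "submodule H M \<longleftrightarrow> M \<subseteq> carr H \<and> 0 \<in> M \<and> (\<forall>x\<in>M. \<forall>y\<in>M. x + y \<in> M)
     \<and> (\<forall>c. \<forall>x\<in>M. c *\<^sub>C x \<in> M) \<and> (\<forall>a. \<forall>x\<in>M. act H x a \<in> M)"

text \<open>The inner product is linear in the second variable.\<close>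

locale hilbert_module =
  fixes H :: "('a::cstar_algebra, 'h::complex_normed_vector) hmod"
  assumes carr_submodule: "submodule H (carr H)"
    and act_add_left: "\<lbrakk>x \<in> carr H; y \<in> carr H\<rbrakk> \<Longrightarrow> act H (x + y) a = act H x a + act H y a"
    and act_add_right: "x \<in> carr H \<Longrightarrow> act H x (a + b) = act H x a + act H x b"
    and act_mult: "x \<in> carr H \<Longrightarrow> act H x (a * b) = act H (act H x a) b"
    and act_scaleC_left: "x \<in> carr H \<Longrightarrow> act H (c *\<^sub>C x) a = c *\<^sub>C act H x a"
    and act_scaleC_right: "x \<in> carr H \<Longrightarrow> act H x (c *\<^sub>C a) = c *\<^sub>C act H x a"
    and ip_add: "\<lbrakk>x \<in> carr H; y \<in> carr H; z \<in> carr H\<rbrakk> \<Longrightarrow> ip H x (y + z) = ip H x y + ip H x z"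
    and ip_scaleC: "\<lbrakk>x \<in> carr H; y \<in> carr H\<rbrakk> \<Longrightarrow> ip H x (c *\<^sub>C y) = c *\<^sub>C ip H x y"
    and ip_act: "\<lbrakk>x \<in> carr H; y \<in> carr H\<rbrakk> \<Longrightarrow> ip H x (act H y a) = ip H x y * a"
    and ip_star: "\<lbrakk>x \<in> carr H; y \<in> carr H\<rbrakk> \<Longrightarrow> star (ip H x y) = ip H y x"
    and ip_positive: "x \<in> carr H \<Longrightarrow> cstar_positive (ip H x x)"
    and ip_definite: "\<lbrakk>x \<in> carr H; ip H x x = 0\<rbrakk> \<Longrightarrow> x = 0"
    and norm_ip: "x \<in> carr H \<Longrightarrow> norm x = sqrt (norm (ip H x x))"
    and complete_carr: "complete (carr H)"

abbreviation sub_hmod :: "('a, 'h) hmod \<Rightarrow> 'h set \<Rightarrow> ('a, 'h) hmod" where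
  "sub_hmod H M \<equiv> H\<lparr>carr := M\<rparr>"

definition perp :: "('a::cstar_algebra, 'h) hmod \<Rightarrow> 'h set \<Rightarrow> 'h set" where
  "perp H M = {x \<in> carr H. \<forall>m\<in>M. ip H m x = 0}"

definition set_sum :: "'h::ab_group_add set \<Rightarrow> 'h set \<Rightarrow> 'h set" where
  "set_sum A B = {a + b | a b. a \<in> A \<and> b \<in> B}"

definition orth_complemented :: "('a::cstar_algebra, 'h::complex_normed_vector) hmod \<Rightarrow> 'h set \<Rightarrow> bool" where
  "orth_complemented H M \<longleftrightarrow> submodule H M \<and> closed M \<and> carr H = set_sum M (perp H M)"

definition proj :: "('a::cstar_algebra, 'h::complex_normed_vector) hmod \<Rightarrow> 'h set \<Rightarrow> 'h \<Rightarrow> 'h" where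
  "proj H M = restrict (\<lambda>x. THE m. m \<in> M \<and> x - m \<in> perp H M) (carr H)"

definition proj_perp :: "('a::cstar_algebra, 'h::complex_normed_vector) hmod \<Rightarrow> 'h set \<Rightarrow> 'h \<Rightarrow> 'h" where
  "proj_perp H M = restrict (\<lambda>x. x - proj H M x) (carr H)"

text \<open>
  Operators are extensional functions, so that equality of operators is equality of functions.
  Adjointable maps are automatically linear, module maps and bounded.
\<close>

definition is_adjoint :: "('a, 'h) hmod \<Rightarrow> ('a, 'k) hmod \<Rightarrow> ('h \<Rightarrow> 'k) \<Rightarrow> ('k \<Rightarrow> 'h) \<Rightarrow> bool" where
  "is_adjoint H K T S \<longleftrightarrow> S \<in> carr K \<rightarrow>\<^sub>E carr H
     \<and> (\<forall>x\<in>carr H. \<forall>y\<in>carr K. ip K (T x) y = ip H x (S y))"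

definition adjointables :: "('a, 'h) hmod \<Rightarrow> ('a, 'k) hmod \<Rightarrow> ('h \<Rightarrow> 'k) set" where
  "adjointables H K = {T \<in> carr H \<rightarrow>\<^sub>E carr K. \<exists>S. is_adjoint H K T S}"

definition adj :: "('a, 'h) hmod \<Rightarrow> ('a, 'k) hmod \<Rightarrow> ('h \<Rightarrow> 'k) \<Rightarrow> 'k \<Rightarrow> 'h" where
  "adj H K T = (THE S. is_adjoint H K T S)"

definition op_range :: "('a, 'h) hmod \<Rightarrow> ('h \<Rightarrow> 'k) \<Rightarrow> 'k set" where
  "op_range H T = T ` carr H"

definition op_null :: "('a, 'h) hmod \<Rightarrow> ('h \<Rightarrow> 'k::zero) \<Rightarrow> 'h set" where
  "op_null H T = {x \<in> carr H. T x = 0}"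

text \<open>As for \<open>cstar_positive\<close>, now in the C*-algebra of adjointable operators on a Hilbert module.\<close>

definition op_positive :: "('a, 'h) hmod \<Rightarrow> ('h \<Rightarrow> 'h) \<Rightarrow> bool" where
  "op_positive H P \<longleftrightarrow> (\<exists>B\<in>adjointables H H. P = compose (carr H) (adj H H B) B)"

definition op_sqrt :: "('a, 'h) hmod \<Rightarrow> ('h \<Rightarrow> 'h) \<Rightarrow> 'h \<Rightarrow> 'h" where
  "op_sqrt H P = (THE S. op_positive H S \<and> compose (carr H) S S = P)"

definition op_abs :: "('a, 'h) hmod \<Rightarrow> ('a, 'k) hmod \<Rightarrow> ('h \<Rightarrow> 'k) \<Rightarrow> 'h \<Rightarrow> 'h" where
  "op_abs H K T = op_sqrt H (compose (carr H) (adj H K T) T)"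

definition complementable ::
  "('a::cstar_algebra, 'h::complex_normed_vector) hmod \<Rightarrow> ('a, 'k::complex_normed_vector) hmod
     \<Rightarrow> 'h set \<Rightarrow> 'k set \<Rightarrow> ('h \<Rightarrow> 'k) \<Rightarrow> bool" where
  "complementable H K M N T \<longleftrightarrow> T \<in> adjointables H K \<and>
     (\<exists>Mr\<in>adjointables H H. \<exists>Ml\<in>adjointables K K.
        (\<forall>x\<in>carr H. proj_perp H M (Mr x) = Mr x) \<and>
        (\<forall>y\<in>carr K. Ml (proj_perp K N y) = Ml y) \<and>
        (\<forall>x\<in>carr H. proj_perp K N (T (Mr x)) = proj_perp K N (T x)) \<and>
        (\<forall>x\<in>carr H. Ml (T (proj_perp H M x)) = T (proj_perp H M x)))"

definition is_reduced_solution ::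
  "('a, 'h::topological_space) hmod \<Rightarrow> ('a, 'k) hmod \<Rightarrow> ('a, 'e) hmod
     \<Rightarrow> ('h \<Rightarrow> 'k) \<Rightarrow> ('e \<Rightarrow> 'k) \<Rightarrow> ('e \<Rightarrow> 'h) \<Rightarrow> bool" where
  "is_reduced_solution H K E A C D \<longleftrightarrow> D \<in> adjointables E H \<and> compose (carr E) A D = C
     \<and> op_range E D \<subseteq> closure (op_range K (adj H K A))"

definition reduced_solution ::
  "('a, 'h::topological_space) hmod \<Rightarrow> ('a, 'k) hmod \<Rightarrow> ('a, 'e) hmod
     \<Rightarrow> ('h \<Rightarrow> 'k) \<Rightarrow> ('e \<Rightarrow> 'k) \<Rightarrow> 'e \<Rightarrow> 'h" where
  "reduced_solution H K E A C = (THE D. is_reduced_solution H K E A C D)"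

definition sqrt_abs :: "('a, 'h) hmod \<Rightarrow> ('a, 'k) hmod \<Rightarrow> ('h \<Rightarrow> 'k) \<Rightarrow> 'h \<Rightarrow> 'h" where
  "sqrt_abs H K R = op_sqrt H (op_abs H K R)"

definition sqrt_abs_adj :: "('a, 'h) hmod \<Rightarrow> ('a, 'k) hmod \<Rightarrow> ('h \<Rightarrow> 'k) \<Rightarrow> 'k \<Rightarrow> 'k" where
  "sqrt_abs_adj H K R = sqrt_abs K H (adj H K R)"

definition V_op :: "('a, 'h) hmod \<Rightarrow> ('a, 'k::topological_space) hmod \<Rightarrow> ('h \<Rightarrow> 'k) \<Rightarrow> 'h \<Rightarrow> 'k" where
  "V_op H K R = reduced_solution K K H (sqrt_abs_adj H K R) R"

text \<open>
  Only the carrier and the inner product of the external direct sum are used below (to form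
  adjoints). The norm of the product type is equivalent to, but different from, the Hilbert
  module norm of the sum, so this is not an instance of the locale \<open>hilbert_module\<close>.
\<close>

definition hmod_sum :: "('a::plus, 'h) hmod \<Rightarrow> ('a, 'k) hmod \<Rightarrow> ('a, 'h \<times> 'k) hmod" where
  "hmod_sum H K = \<lparr>carr = carr H \<times> carr K,
     ip = (\<lambda>(x, y) (x', y'). ip H x x' + ip K y y'),
     act = (\<lambda>(x, y) a. (act H x a, act K y a))\<rparr>"

definition decomp_unitary ::
  "('a::cstar_algebra, 'h::complex_normed_vector) hmod \<Rightarrow> 'h set \<Rightarrow> 'h \<Rightarrow> 'h \<times> 'h" where
  "decomp_unitary H M = restrict (\<lambda>x. (proj H M x, proj_perp H M x)) (carr H)"

definition decomp_unitary_adj ::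
  "('a::cstar_algebra, 'h::complex_normed_vector) hmod \<Rightarrow> 'h set \<Rightarrow> 'h \<times> 'h \<Rightarrow> 'h" where
  "decomp_unitary_adj H M =
     adj H (hmod_sum (sub_hmod H M) (sub_hmod H (perp H M))) (decomp_unitary H M)"

definition block_matrix ::
  "('x \<Rightarrow> 'u) \<Rightarrow> ('y \<Rightarrow> 'u) \<Rightarrow> ('x \<Rightarrow> 'v) \<Rightarrow> ('y \<Rightarrow> 'v) \<Rightarrow> 'x \<times> 'y \<Rightarrow> 'u::plus \<times> 'v::plus" where
  "block_matrix A11 A12 A21 A22 = (\<lambda>(x, y). (A11 x + A12 y, A21 x + A22 y))"

locale block_operator =
  fixes H :: "('a::cstar_algebra, 'h::complex_normed_vector) hmod"
    and K :: "('a, 'k::complex_normed_vector) hmod"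
    and M :: "'h set" and N :: "'k set" and T :: "'h \<Rightarrow> 'k"
begin

abbreviation "HM \<equiv> sub_hmod H M"
abbreviation "HM' \<equiv> sub_hmod H (perp H M)"
abbreviation "KN \<equiv> sub_hmod K N"
abbreviation "KN' \<equiv> sub_hmod K (perp K N)"

definition "T11 = restrict (\<lambda>x. proj K N (T (proj H M x))) M"
definition "T12 = restrict (\<lambda>x. proj K N (T (proj_perp H M x))) (perp H M)"
definition "T21 = restrict (\<lambda>x. proj_perp K N (T (proj H M x))) M"
definition "T22 = restrict (\<lambda>x. proj_perp K N (T (proj_perp H M x))) (perp H M)"

abbreviation "V22 \<equiv> V_op HM' KN' T22"
abbreviation "T12_adj \<equiv> adj HM' KN T12"

definition weakly_complementable :: bool where
  "weakly_complementable \<longleftrightarrow> T \<in> adjointables H K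
     \<and> (\<exists>Y1. is_reduced_solution HM' KN' HM V22 T21 Y1)
     \<and> (\<exists>Y2. is_reduced_solution HM' HM' KN (sqrt_abs HM' KN' T22) T12_adj Y2)
     \<and> (\<exists>Z1. is_reduced_solution KN' KN' HM (sqrt_abs_adj HM' KN' T22) T21 Z1)
     \<and> (\<exists>Z2. is_reduced_solution KN' HM' KN (adj HM' KN' V22) T12_adj Z2)"

definition "E = reduced_solution HM' KN' HM V22 T21"
definition "F = reduced_solution HM' HM' KN (sqrt_abs HM' KN' T22) T12_adj"
definition "E_tilde = reduced_solution KN' KN' HM (sqrt_abs_adj HM' KN' T22) T21"
definition "F_tilde = reduced_solution KN' HM' KN (adj HM' KN' V22) T12_adj"

definition schur_block :: "'h \<Rightarrow> 'k" where
  "schur_block = restrict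
     (\<lambda>x. T11 x - (1/2) *\<^sub>R (adj KN HM' F (E x) + adj KN KN' F_tilde (E_tilde x))) M"

text \<open>Meaningful for weakly complementable operators, where the reduced solutions exist.\<close>

definition bilateral_shorted :: "'h \<Rightarrow> 'k" where
  "bilateral_shorted = restrict
     (\<lambda>x. decomp_unitary_adj K N
        (block_matrix schur_block (\<lambda>_. 0) (\<lambda>_. 0) (\<lambda>_. 0) (decomp_unitary H M x))) (carr H)"

end

end

theory Submission
  imports Defs
begin

text \<open>
  Complementability factors the off-diagonal blocks adjointably through \<open>T\<^sub>2\<^sub>2\<close>: \<open>T\<^sub>2\<^sub>1 = T\<^sub>2\<^sub>2 X\<close> and
  \<open>T\<^sub>1\<^sub>2 = Y T\<^sub>2\<^sub>2\<close>. With \<open>R = T\<^sub>2\<^sub>2\<close>, \<open>A = |R*|\<^sup>1\<^sup>/\<^sup>2\<close>, \<open>A' = |R|\<^sup>1\<^sup>/\<^sup>2\<close> and \<open>R = A V = V A'\<close>, the four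
  reduced solutions are \<open>E = A' X\<close>, \<open>F = V* Y*\<close>, and (with tildes) \<open>E = V X\<close>, \<open>F = A Y*\<close>, so both
  correction terms equal \<open>Y R X\<close> and the shorted operator acts on \<open>m \<in> M\<close> as \<open>T (m - X m)\<close>;
  the range and the null space can be read off from this.

  The square roots are limits of a norm-convergent iteration. That \<open>R* R\<close> is positive in the sense
  needed there rests on the monotonicity of the norm on sums of elements \<open>b* b\<close> of the algebra,
  hence on Kaplansky's theorem, which is obtained by applying the same square root to left
  multiplication operators.
\<close>

text \<open>Cauchy-Schwarz is not among the axioms of a Hilbert module. Its proof needs order facts
  of the algebra, these need square roots, and the square root construction in turn uses
  Cauchy-Schwarz. The locale \<open>cs_hilbert_module\<close> breaks the circle: the algebra as a
  module over itself satisfies the inequality by submultiplicativity of the norm. Since no unit is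
  assumed, expressions like 1 - h are formed among the adjointable maps of that module instead of in
  a unitization.

  A second obstacle is that closures of ranges need not be complemented, so R need not have a polar
  decomposition. The half power rescues the factorization: for A = |R*|^(1/2) and G_n = (A +
  1/(n+1))^(-1) the maps A^2 G_n converge to A in norm, and this forces G_n R to converge to V.
  Arguments that would project onto the closure of a range are replaced by the remark that an
  adjointable map is injective on the closure of the range of its adjoint.\<close>

lemma scaleC_zero_right [simp]: "c *\<^sub>C (0::'a::complex_normed_vector) = 0"
  using scaleC_add_right[of c 0 "0::'a"] by simp

lemma scaleC_minus_right: "c *\<^sub>C (- x) = - (c *\<^sub>C (x::'a::complex_normed_vector))"
  using scaleC_add_right[of c x "- x"] by (simp add: eq_neg_iff_add_eq_0 add.commute)

lemma scaleC_diff_right: "c *\<^sub>C (x - y) = c *\<^sub>C x - c *\<^sub>C (y::'a::complex_normed_vector)"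
  using scaleC_add_right[of c x "- y"] by (simp add: scaleC_minus_right)

lemma scaleC_minus_one: "(-1) *\<^sub>C x = - (x::'a::complex_normed_vector)"
  using scaleR_scaleC[of "-1" x] by simp

lemma star_zero [simp]: "star (0::'a::cstar_algebra) = 0"
  using star_add[of 0 "0::'a"] by simp

lemma star_minus: "star (- x) = - star (x::'a::cstar_algebra)"
  using star_add[of x "- x"] by (simp add: eq_neg_iff_add_eq_0 add.commute)

lemma star_diff: "star (x - y) = star x - star (y::'a::cstar_algebra)"
  using star_add[of x "- y"] by (simp add: star_minus)

lemma star_scaleR: "star (r *\<^sub>R x) = r *\<^sub>R star (x::'a::cstar_algebra)"
  by (simp add: scaleR_scaleC star_scaleC)

lemma norm_star [simp]: "norm (star x) = norm (x::'a::cstar_algebra)"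
proof -
  have le: "norm y \<le> norm (star y)" for y :: 'a
  proof (cases "norm y = 0")
    case False
    have "norm y * norm y \<le> norm (star y) * norm y"
      using norm_mult_ineq[of "star y" y] by (simp add: cstar_identity power2_eq_square)
    with False show ?thesis by simp
  qed auto
  show ?thesis using le[of x] le[of "star x"] by (simp add: star_star)
qed

section \<open>Calculus of the algebra-valued inner product\<close>

context hilbert_module
begin

lemma carr_closed [simp, intro]:
  shows "0 \<in> carr H"
    and "\<lbrakk>x \<in> carr H; y \<in> carr H\<rbrakk> \<Longrightarrow> x + y \<in> carr H"
    and "x \<in> carr H \<Longrightarrow> c *\<^sub>C x \<in> carr H"
    and "x \<in> carr H \<Longrightarrow> r *\<^sub>R x \<in> carr H"
    and "x \<in> carr H \<Longrightarrow> - x \<in> carr H"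
    and "\<lbrakk>x \<in> carr H; y \<in> carr H\<rbrakk> \<Longrightarrow> x - y \<in> carr H"
    and "x \<in> carr H \<Longrightarrow> act H x a \<in> carr H"
proof -
  have sub: "submodule H (carr H)" by (rule carr_submodule)
  show *: "0 \<in> carr H" "\<lbrakk>x \<in> carr H; y \<in> carr H\<rbrakk> \<Longrightarrow> x + y \<in> carr H"
    "\<And>c. x \<in> carr H \<Longrightarrow> c *\<^sub>C x \<in> carr H" "x \<in> carr H \<Longrightarrow> act H x a \<in> carr H" for x y
    using sub by (auto simp: submodule_def)
  show "x \<in> carr H \<Longrightarrow> r *\<^sub>R x \<in> carr H" by (simp add: scaleR_scaleC *)
  show m: "x \<in> carr H \<Longrightarrow> - x \<in> carr H" for x using *(3)[of x "-1"] by (simp add: scaleC_minus_one)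
  show "\<lbrakk>x \<in> carr H; y \<in> carr H\<rbrakk> \<Longrightarrow> x - y \<in> carr H" using *(2)[of x "- y"] m by simp
qed

lemma ip_zero_right [simp]: "x \<in> carr H \<Longrightarrow> ip H x 0 = 0"
  using ip_add[of x 0 0] by simp

lemma ip_scaleR: "\<lbrakk>x \<in> carr H; y \<in> carr H\<rbrakk> \<Longrightarrow> ip H x (r *\<^sub>R y) = r *\<^sub>R ip H x y"
  by (simp add: scaleR_scaleC ip_scaleC)

lemma ip_minus: "\<lbrakk>x \<in> carr H; y \<in> carr H\<rbrakk> \<Longrightarrow> ip H x (- y) = - ip H x y"
  using ip_add[of x y "- y"] by (simp add: eq_neg_iff_add_eq_0 add.commute)

lemma ip_diff: "\<lbrakk>x \<in> carr H; y \<in> carr H; z \<in> carr H\<rbrakk> \<Longrightarrow> ip H x (y - z) = ip H x y - ip H x z"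
  using ip_add[of x y "- z"] by (simp add: ip_minus)

lemma ip_zero_left [simp]: "x \<in> carr H \<Longrightarrow> ip H 0 x = 0"
  using ip_star[of x 0] by simp

lemma ip_add_left: "\<lbrakk>x \<in> carr H; y \<in> carr H; z \<in> carr H\<rbrakk> \<Longrightarrow> ip H (x + y) z = ip H x z + ip H y z"
  using ip_star[of z "x + y"] ip_star[of z x] ip_star[of z y] by (simp add: ip_add star_add)

lemma ip_scaleC_left: "\<lbrakk>x \<in> carr H; y \<in> carr H\<rbrakk> \<Longrightarrow> ip H (c *\<^sub>C x) y = cnj c *\<^sub>C ip H x y"
  using ip_star[of y "c *\<^sub>C x"] ip_star[of y x] by (simp add: ip_scaleC star_scaleC)

lemma ip_scaleR_left: "\<lbrakk>x \<in> carr H; y \<in> carr H\<rbrakk> \<Longrightarrow> ip H (r *\<^sub>R x) y = r *\<^sub>R ip H x y"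
  by (simp add: scaleR_scaleC ip_scaleC_left)

lemma ip_minus_left: "\<lbrakk>x \<in> carr H; y \<in> carr H\<rbrakk> \<Longrightarrow> ip H (- x) y = - ip H x y"
  using ip_add_left[of x "- x" y] by (simp add: eq_neg_iff_add_eq_0 add.commute)

lemma ip_diff_left: "\<lbrakk>x \<in> carr H; y \<in> carr H; z \<in> carr H\<rbrakk> \<Longrightarrow> ip H (x - y) z = ip H x z - ip H y z"
  using ip_add_left[of x "- y" z] by (simp add: ip_minus_left)

lemma ip_act_left: "\<lbrakk>x \<in> carr H; y \<in> carr H\<rbrakk> \<Longrightarrow> ip H (act H x a) y = star a * ip H x y"
  using ip_star[of y "act H x a"] ip_star[of y x] by (simp add: ip_act star_mult)

lemmas ip_simps = ip_add ip_diff ip_minus ip_scaleR ip_add_left ip_diff_left ip_minus_left ip_scaleR_left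

lemma norm_ip_self: "x \<in> carr H \<Longrightarrow> norm (ip H x x) = (norm x)\<^sup>2"
  using norm_ip[of x] by simp

lemma ip_eqI:
  assumes "x \<in> carr H" "y \<in> carr H" and "\<And>z. z \<in> carr H \<Longrightarrow> ip H z x = ip H z y"
  shows "x = y"
  using assms ip_definite[of "x - y"] by (simp add: ip_diff)

lemma ip_eqI_left:
  assumes "x \<in> carr H" "y \<in> carr H" and "\<And>z. z \<in> carr H \<Longrightarrow> ip H x z = ip H y z"
  shows "x = y"
  using assms ip_definite[of "x - y"] by (simp add: ip_diff_left)

end

text \<open>A provisional assumption: it is discharged for every \<open>hilbert_module\<close> once
  positivity in the algebra is understood. Until then \<open>self_hmod\<close> is the only
  instance.\<close>

locale cs_hilbert_module = hilbert_module H for H :: "('a::cstar_algebra, 'h::complex_normed_vector) hmod" +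
  assumes Cauchy_Schwarz: "\<lbrakk>x \<in> carr H; y \<in> carr H\<rbrakk> \<Longrightarrow> norm (ip H x y) \<le> norm x * norm y"
begin

lemma tendsto_ip_right:
  assumes "f \<longlonglongrightarrow> l" "\<And>n. f n \<in> carr H" "l \<in> carr H" "y \<in> carr H"
  shows "(\<lambda>n. ip H y (f n)) \<longlonglongrightarrow> ip H y l"
proof -
  have "(\<lambda>n. norm y * norm (f n - l)) \<longlonglongrightarrow> norm y * 0"
    by (intro tendsto_mult tendsto_const tendsto_norm_zero) (use assms(1) in \<open>simp add: LIM_zero\<close>)
  moreover have "norm (ip H y (f n) - ip H y l) \<le> norm y * norm (f n - l)" for n
    using Cauchy_Schwarz[of y "f n - l"] assms by (simp add: ip_diff)
  ultimately have "(\<lambda>n. ip H y (f n) - ip H y l) \<longlonglongrightarrow> 0"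
    using Lim_null_comparison[OF always_eventually[OF allI]] by fastforce
  then show ?thesis by (simp add: LIM_zero_cancel)
qed

lemma tendsto_ip_left:
  assumes "f \<longlonglongrightarrow> l" "\<And>n. f n \<in> carr H" "l \<in> carr H" "y \<in> carr H"
  shows "(\<lambda>n. ip H (f n) y) \<longlonglongrightarrow> ip H l y"
proof -
  have "(\<lambda>n. norm (f n - l) * norm y) \<longlonglongrightarrow> 0 * norm y"
    by (intro tendsto_mult tendsto_const tendsto_norm_zero) (use assms(1) in \<open>simp add: LIM_zero\<close>)
  moreover have "norm (ip H (f n) y - ip H l y) \<le> norm (f n - l) * norm y" for n
    using Cauchy_Schwarz[of "f n - l" y] assms by (simp add: ip_diff_left)
  ultimately have "(\<lambda>n. ip H (f n) y - ip H l y) \<longlonglongrightarrow> 0"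
    using Lim_null_comparison[OF always_eventually[OF allI]] by fastforce
  then show ?thesis by (simp add: LIM_zero_cancel)
qed

end

text \<open>Unlike in \<open>is_adjoint\<close>, nothing has to be extensional, so pairs are
  symmetric and compose as plain lambda terms. \<open>restrict\<close> returns only when the given
  definitions have to be met.\<close>

definition adjoint_pair :: "('a, 'h) hmod \<Rightarrow> ('a, 'k) hmod \<Rightarrow> ('h \<Rightarrow> 'k) \<Rightarrow> ('k \<Rightarrow> 'h) \<Rightarrow> bool" where
  "adjoint_pair H K T S \<longleftrightarrow> T \<in> carr H \<rightarrow> carr K \<and> S \<in> carr K \<rightarrow> carr H
     \<and> (\<forall>x\<in>carr H. \<forall>y\<in>carr K. ip K (T x) y = ip H x (S y))"

lemma adjoint_pairD:
  assumes "adjoint_pair H K T S"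
  shows "x \<in> carr H \<Longrightarrow> T x \<in> carr K" and "y \<in> carr K \<Longrightarrow> S y \<in> carr H"
    and "\<lbrakk>x \<in> carr H; y \<in> carr K\<rbrakk> \<Longrightarrow> ip K (T x) y = ip H x (S y)"
  using assms by (auto simp: adjoint_pair_def)

lemma adjoint_pair_sym:
  assumes "hilbert_module H" "hilbert_module K" "adjoint_pair H K T S"
  shows "adjoint_pair K H S T"
  unfolding adjoint_pair_def
proof (intro conjI ballI)
  interpret H: hilbert_module H by fact
  interpret K: hilbert_module K by fact
  note D = adjoint_pairD[OF assms(3)]
  show "S \<in> carr K \<rightarrow> carr H" "T \<in> carr H \<rightarrow> carr K" using D by auto
  fix y x assume *: "y \<in> carr K" "x \<in> carr H"
  have "ip H (S y) x = star (ip H x (S y))" using * D by (simp add: H.ip_star)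
  also have "\<dots> = star (ip K (T x) y)" using * D by simp
  finally show "ip H (S y) x = ip K y (T x)" using * D(1) K.ip_star[of "T x" y] by simp
qed

lemma adjoint_pair_comp:
  assumes "adjoint_pair H K T S" "adjoint_pair K L T' S'"
  shows "adjoint_pair H L (\<lambda>x. T' (T x)) (\<lambda>y. S (S' y))"
  using assms by (auto simp: adjoint_pair_def Pi_iff)

text \<open>Linearity is not part of \<open>adjoint_pair\<close>; it follows because the inner
  product separates points.\<close>

lemma adjoint_pair_linear:
  assumes "hilbert_module H" "hilbert_module K" "adjoint_pair H K T S"
  shows "\<lbrakk>x \<in> carr H; y \<in> carr H\<rbrakk> \<Longrightarrow> T (x + y) = T x + T y"
    and "\<lbrakk>x \<in> carr H; y \<in> carr H\<rbrakk> \<Longrightarrow> T (x - y) = T x - T y"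
    and "x \<in> carr H \<Longrightarrow> T (r *\<^sub>R x) = r *\<^sub>R T x"
    and "x \<in> carr H \<Longrightarrow> T (- x) = - T x"
    and "T 0 = 0"
proof -
  interpret H: hilbert_module H by fact
  interpret K: hilbert_module K by fact
  note D = adjoint_pairD[OF assms(3)]
  show a: "T (x + y) = T x + T y" if "x \<in> carr H" "y \<in> carr H" for x y
    by (rule K.ip_eqI_left) (use that D in \<open>auto simp: K.ip_simps H.ip_simps\<close>)
  show s: "T (r *\<^sub>R x) = r *\<^sub>R T x" if "x \<in> carr H" for x r
    by (rule K.ip_eqI_left) (use that D in \<open>auto simp: K.ip_simps H.ip_simps\<close>)
  show m: "T (- x) = - T x" if "x \<in> carr H" for x
    using s[OF that, of "-1"] by simp
  show "T (x - y) = T x - T y" if "x \<in> carr H" "y \<in> carr H"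
    using a[of x "- y"] m[of y] that by simp
  show "T 0 = 0" using s[of 0 0] by simp
qed

subsection \<open>The square root iteration\<close>

text \<open>For a selfadjoint contraction \<open>Q\<close> this iteration converges to \<open>1 - sqrt (1 - Q)\<close>;
  comparison with the scalar case \<open>Q = 1\<close> gives the rate.\<close>

fun sqrt_iter :: "('h::real_vector \<Rightarrow> 'h) \<Rightarrow> nat \<Rightarrow> 'h \<Rightarrow> 'h" where
  "sqrt_iter Q 0 x = 0"
| "sqrt_iter Q (Suc n) x = (1/2) *\<^sub>R (Q x + sqrt_iter Q n (sqrt_iter Q n x))"

fun scalar_iter :: "nat \<Rightarrow> real" where
  "scalar_iter 0 = 0"
| "scalar_iter (Suc n) = (1 + (scalar_iter n)\<^sup>2) / 2"

definition sqrt_compl :: "('h::real_normed_vector \<Rightarrow> 'h) \<Rightarrow> 'h \<Rightarrow> 'h" where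
  "sqrt_compl Q x = lim (\<lambda>n. sqrt_iter Q n x)"

lemma scalar_iter_bounds: "0 \<le> scalar_iter n \<and> scalar_iter n \<le> 1"
proof (induction n)
  case (Suc n)
  then show ?case by (auto simp: power_le_one)
qed auto

lemma scalar_iter_mono: "scalar_iter n \<le> scalar_iter (Suc n)"
  using sum_squares_bound[of 1 "scalar_iter n"] by (simp add: field_simps)

lemma scalar_iter_Cauchy: "Cauchy scalar_iter"
  by (rule convergent_Cauchy, rule Bseq_mono_convergent)
    (use scalar_iter_bounds in \<open>auto intro!: BseqI'[where K = 1] lift_Suc_mono_le scalar_iter_mono simp del: scalar_iter.simps\<close>)

text \<open>Each iterate is a polynomial in \<open>Q\<close>, so a map that intertwines
  \<open>Q\<close> and \<open>Q'\<close> intertwines the iterates. Taking an iterate itself for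
  \<open>W\<close> shows that iterates commute.\<close>

lemma sqrt_iter_intertwine:
  assumes "hilbert_module H" "hilbert_module K" and W: "adjoint_pair H K W W'"
    and Q: "adjoint_pair H H Q Q" and Q': "adjoint_pair K K Q' Q'"
    and comm: "\<And>x. x \<in> carr H \<Longrightarrow> W (Q x) = Q' (W x)"
  shows "x \<in> carr H \<Longrightarrow> sqrt_iter Q n x \<in> carr H \<and> W (sqrt_iter Q n x) = sqrt_iter Q' n (W x)"
proof (induction n arbitrary: x)
  interpret H: hilbert_module H by fact
  interpret K: hilbert_module K by fact
  note D = adjoint_pairD[OF W] adjoint_pairD[OF Q] adjoint_pairD[OF Q']
  note L = adjoint_pair_linear[OF assms(1,2) W]
  { case 0 then show ?case by (simp add: L) }
  { case (Suc n) then show ?case by (simp add: L D comm) }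
qed

locale sa_contraction = cs_hilbert_module H for H :: "('a::cstar_algebra, 'h::complex_normed_vector) hmod" +
  fixes Q
  assumes Q_sa: "adjoint_pair H H Q Q" and Q_contr: "x \<in> carr H \<Longrightarrow> norm (Q x) \<le> norm x"
begin

lemmas hilb = hilbert_module_axioms

lemma sqrt_iter_in: "x \<in> carr H \<Longrightarrow> sqrt_iter Q n x \<in> carr H"
  using sqrt_iter_intertwine[OF hilb hilb Q_sa Q_sa Q_sa] by blast

lemma sqrt_iter_sa: "adjoint_pair H H (sqrt_iter Q n) (sqrt_iter Q n)"
proof (induction n)
  case 0 then show ?case by (auto simp: adjoint_pair_def)
next
  case (Suc n)
  note D = adjoint_pairD[OF Q_sa] adjoint_pairD[OF Suc]
  show ?case
    unfolding adjoint_pair_def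
    by (auto simp: ip_simps D)
qed

lemma sqrt_iter_comm:
  assumes "x \<in> carr H"
  shows "sqrt_iter Q m (sqrt_iter Q n x) = sqrt_iter Q n (sqrt_iter Q m x)"
proof -
  have 1: "Q (sqrt_iter Q n x) = sqrt_iter Q n (Q x)" if "x \<in> carr H" for x n
    using sqrt_iter_intertwine[OF hilb hilb Q_sa Q_sa Q_sa _ that] by simp
  show ?thesis
    using sqrt_iter_intertwine[OF hilb hilb sqrt_iter_sa Q_sa Q_sa _ assms, of n m] 1
    by simp
qed

lemma norm_sqrt_iter: "x \<in> carr H \<Longrightarrow> norm (sqrt_iter Q n x) \<le> scalar_iter n * norm x"
proof (induction n arbitrary: x)
  case (Suc n)
  have "norm (sqrt_iter Q (Suc n) x) \<le> (1/2) * (norm (Q x) + norm (sqrt_iter Q n (sqrt_iter Q n x)))"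
    by (simp add: norm_triangle_ineq)
  also have "norm (sqrt_iter Q n (sqrt_iter Q n x)) \<le> scalar_iter n * norm (sqrt_iter Q n x)"
    using Suc sqrt_iter_in by blast
  also have "\<dots> \<le> scalar_iter n * (scalar_iter n * norm x)"
    using Suc scalar_iter_bounds by (intro mult_left_mono) auto
  also have "(1/2) * (norm (Q x) + scalar_iter n * (scalar_iter n * norm x))
      \<le> (1/2) * (norm x + scalar_iter n * (scalar_iter n * norm x))"
    using Q_contr[OF Suc.prems] by simp
  finally show ?case by (simp add: algebra_simps power2_eq_square)
qed auto

text \<open>Consecutive iterates a and b commute, so a^2 - b^2 = (a - b)(a + b) exactly as for
  scalars. Each increment is therefore dominated by the scalar increment, and the Cauchy property is
  inherited from \<open>scalar_iter\<close>.\<close>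

lemma norm_sqrt_iter_step:
  "x \<in> carr H \<Longrightarrow> norm (sqrt_iter Q (Suc n) x - sqrt_iter Q n x) \<le> (scalar_iter (Suc n) - scalar_iter n) * norm x"
proof (induction n arbitrary: x)
  case 0
  then show ?case using Q_contr by simp
next
  case (Suc n)
  define a where "a = sqrt_iter Q (Suc n)"
  define b where "b = sqrt_iter Q n"
  define \<alpha> where "\<alpha> = scalar_iter (Suc n)"
  define \<beta> where "\<beta> = scalar_iter n"
  have ab: "\<beta> \<le> \<alpha>" "0 \<le> \<beta>" using scalar_iter_bounds[of n] scalar_iter_mono unfolding \<alpha>_def \<beta>_def by auto
  have in_a: "a y \<in> carr H" "b y \<in> carr H" if "y \<in> carr H" for y
    using that sqrt_iter_in unfolding a_def b_def by blast+
  have lin: "a (y + z) = a y + a z" "b (y + z) = b y + b z" if "y \<in> carr H" "z \<in> carr H" for y z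
    using adjoint_pair_linear(1)[OF hilb hilb sqrt_iter_sa] that unfolding a_def b_def by (auto simp del: sqrt_iter.simps)
  have c: "a (b x) = b (a x)" using sqrt_iter_comm Suc.prems unfolding a_def b_def by blast
  let ?y = "a x + b x"
  have y: "?y \<in> carr H" using in_a Suc.prems by auto
  have "sqrt_iter Q (Suc (Suc n)) x - sqrt_iter Q (Suc n) x
      = (1/2) *\<^sub>R (Q x + a (a x)) - (1/2) *\<^sub>R (Q x + b (b x))"
    unfolding a_def b_def by simp
  also have "\<dots> = (1/2) *\<^sub>R (a ?y - b ?y)"
    using in_a Suc.prems c by (simp add: lin algebra_simps)
  finally have "norm (sqrt_iter Q (Suc (Suc n)) x - sqrt_iter Q (Suc n) x) = (1/2) * norm (a ?y - b ?y)"
    by simp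
  also have "\<dots> \<le> (1/2) * ((\<alpha> - \<beta>) * norm ?y)"
    using Suc.IH[OF y] unfolding a_def b_def \<alpha>_def \<beta>_def by simp
  also have "norm ?y \<le> (\<alpha> + \<beta>) * norm x"
    using norm_triangle_ineq[of "a x" "b x"] norm_sqrt_iter[OF Suc.prems, of n] norm_sqrt_iter[OF Suc.prems, of "Suc n"]
    unfolding a_def b_def \<alpha>_def \<beta>_def by (simp add: distrib_right del: scalar_iter.simps sqrt_iter.simps)
  also have "(1/2) * ((\<alpha> - \<beta>) * ((\<alpha> + \<beta>) * norm x)) = (scalar_iter (Suc (Suc n)) - scalar_iter (Suc n)) * norm x"
    by (simp add: \<alpha>_def[symmetric] \<beta>_def[symmetric] scalar_iter.simps(2)[of "Suc n"] scalar_iter.simps(2)[of n] del: scalar_iter.simps)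
      (simp add: \<alpha>_def \<beta>_def algebra_simps power2_eq_square)
  finally show ?case using ab by (simp add: mult_left_mono)
qed

lemma norm_sqrt_iter_diff:
  assumes "x \<in> carr H" "m \<le> n"
  shows "norm (sqrt_iter Q n x - sqrt_iter Q m x) \<le> (scalar_iter n - scalar_iter m) * norm x"
  using assms(2)
proof (induction n rule: dec_induct)
  case (step n)
  then show ?case
    using norm_sqrt_iter_step[OF assms(1), of n]
      norm_triangle_ineq[of "sqrt_iter Q (Suc n) x - sqrt_iter Q n x" "sqrt_iter Q n x - sqrt_iter Q m x"]
    by (simp add: algebra_simps del: scalar_iter.simps sqrt_iter.simps)
qed auto

lemma sqrt_compl_lim:
  assumes "x \<in> carr H"
  shows "(\<lambda>n. sqrt_iter Q n x) \<longlonglongrightarrow> sqrt_compl Q x" and "sqrt_compl Q x \<in> carr H"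
proof -
  have "Cauchy (\<lambda>n. sqrt_iter Q n x)"
    unfolding Cauchy_altdef2
  proof (intro allI impI)
    fix e :: real assume e: "e > 0"
    have x1: "norm x + 1 > 0" by (simp add: add_nonneg_pos)
    with e have pos: "e / (norm x + 1) > 0" by simp
    then obtain N where N: "\<And>n. n \<ge> N \<Longrightarrow> \<bar>scalar_iter n - scalar_iter N\<bar> < e / (norm x + 1)"
      using scalar_iter_Cauchy unfolding Cauchy_altdef2 dist_real_def by blast
    show "\<exists>N. \<forall>n\<ge>N. dist (sqrt_iter Q n x) (sqrt_iter Q N x) < e"
    proof (intro exI allI impI)
      fix n assume n: "n \<ge> N"
      have "dist (sqrt_iter Q n x) (sqrt_iter Q N x) \<le> (scalar_iter n - scalar_iter N) * norm x"
        using norm_sqrt_iter_diff[OF assms n] by (simp add: dist_norm)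
      also have "\<dots> \<le> (e / (norm x + 1)) * norm x"
        using N[OF n] by (intro mult_right_mono) auto
      also have "\<dots> < (e / (norm x + 1)) * (norm x + 1)" using pos by (intro mult_strict_left_mono) auto
      also have "\<dots> = e" using x1 by simp
      finally show "dist (sqrt_iter Q n x) (sqrt_iter Q N x) < e" .
    qed
  qed
  then obtain l where l: "l \<in> carr H" "(\<lambda>n. sqrt_iter Q n x) \<longlonglongrightarrow> l"
    using completeE[OF complete_carr, of "\<lambda>n. sqrt_iter Q n x"] sqrt_iter_in[OF assms] by blast
  then show "(\<lambda>n. sqrt_iter Q n x) \<longlonglongrightarrow> sqrt_compl Q x" "sqrt_compl Q x \<in> carr H"
    using limI unfolding sqrt_compl_def by auto
qed

lemma norm_sqrt_compl:
  assumes "x \<in> carr H"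
  shows "norm (sqrt_compl Q x) \<le> norm x"
proof (rule LIMSEQ_le_const2)
  show "(\<lambda>n. norm (sqrt_iter Q n x)) \<longlonglongrightarrow> norm (sqrt_compl Q x)"
    by (intro tendsto_norm sqrt_compl_lim assms)
  show "\<exists>N. \<forall>n\<ge>N. norm (sqrt_iter Q n x) \<le> norm x"
    using norm_sqrt_iter[OF assms] scalar_iter_bounds
    by (meson mult_left_le_one_le norm_ge_zero order_trans)
qed

lemma sqrt_compl_sa: "adjoint_pair H H (sqrt_compl Q) (sqrt_compl Q)"
  unfolding adjoint_pair_def
proof (intro conjI ballI)
  fix x y assume *: "x \<in> carr H" "y \<in> carr H"
  have "(\<lambda>n. ip H (sqrt_iter Q n x) y) \<longlonglongrightarrow> ip H (sqrt_compl Q x) y"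
    using * by (intro tendsto_ip_left sqrt_compl_lim sqrt_iter_in)
  moreover have "(\<lambda>n. ip H x (sqrt_iter Q n y)) \<longlonglongrightarrow> ip H x (sqrt_compl Q y)"
    using * by (intro tendsto_ip_right sqrt_compl_lim sqrt_iter_in)
  moreover have "ip H (sqrt_iter Q n x) y = ip H x (sqrt_iter Q n y)" for n
    using adjoint_pairD(3)[OF sqrt_iter_sa] * by blast
  ultimately show "ip H (sqrt_compl Q x) y = ip H x (sqrt_compl Q y)"
    using LIMSEQ_unique by auto
qed (auto intro: sqrt_compl_lim)

text \<open>The limit Y is a fixed point, Y = (Q + Y^2) / 2, which rearranges to (1 - Y)^2 = 1 -
  Q.\<close>

lemma sqrt_compl_square:
  assumes x: "x \<in> carr H"
  shows "(x - sqrt_compl Q x) - sqrt_compl Q (x - sqrt_compl Q x) = x - Q x"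
proof -
  let ?Y = "sqrt_compl Q"
  have Yx: "?Y x \<in> carr H" by (rule sqrt_compl_lim(2)[OF x])
  \<comment> \<open>In the squared iterate both factors move with n. As all iterates are
    contractions, the inner one may be replaced by its limit.\<close>
  have "(\<lambda>n. norm (sqrt_iter Q n (sqrt_iter Q n x - ?Y x))) \<longlonglongrightarrow> 0"
  proof (rule Lim_null_comparison)
    show "\<forall>\<^sub>F n in sequentially. norm (norm (sqrt_iter Q n (sqrt_iter Q n x - ?Y x))) \<le> norm (sqrt_iter Q n x - ?Y x)"
    proof (rule always_eventually, rule allI)
      fix n
      have "norm (sqrt_iter Q n (sqrt_iter Q n x - ?Y x)) \<le> scalar_iter n * norm (sqrt_iter Q n x - ?Y x)"
        by (rule norm_sqrt_iter) (use x Yx sqrt_iter_in in auto)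
      also have "\<dots> \<le> norm (sqrt_iter Q n x - ?Y x)"
        using scalar_iter_bounds by (simp add: mult_left_le_one_le)
      finally show "norm (norm (sqrt_iter Q n (sqrt_iter Q n x - ?Y x))) \<le> norm (sqrt_iter Q n x - ?Y x)" by simp
    qed
    show "(\<lambda>n. norm (sqrt_iter Q n x - ?Y x)) \<longlonglongrightarrow> 0"
      using sqrt_compl_lim(1)[OF x] by (intro tendsto_norm_zero LIM_zero)
  qed
  then have 1: "(\<lambda>n. sqrt_iter Q n (sqrt_iter Q n x - ?Y x)) \<longlonglongrightarrow> 0"
    by (rule tendsto_norm_zero_cancel)
  have "sqrt_iter Q n (sqrt_iter Q n x) = sqrt_iter Q n (sqrt_iter Q n x - ?Y x) + sqrt_iter Q n (?Y x)" for n
    using adjoint_pair_linear(2)[OF hilb hilb sqrt_iter_sa] x Yx sqrt_iter_in by auto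
  moreover have "(\<lambda>n. sqrt_iter Q n (sqrt_iter Q n x - ?Y x) + sqrt_iter Q n (?Y x)) \<longlonglongrightarrow> 0 + ?Y (?Y x)"
    by (intro tendsto_add 1 sqrt_compl_lim Yx)
  ultimately have "(\<lambda>n. sqrt_iter Q n (sqrt_iter Q n x)) \<longlonglongrightarrow> ?Y (?Y x)" by simp
  then have "(\<lambda>n. sqrt_iter Q (Suc n) x) \<longlonglongrightarrow> (1/2) *\<^sub>R (Q x + ?Y (?Y x))"
    by (auto intro!: tendsto_intros)
  moreover have "(\<lambda>n. sqrt_iter Q (Suc n) x) \<longlonglongrightarrow> ?Y x"
    using sqrt_compl_lim(1)[OF x] by (rule LIMSEQ_Suc)
  ultimately have eq: "?Y x = (1/2) *\<^sub>R (Q x + ?Y (?Y x))" using LIMSEQ_unique by blast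
  have "2 *\<^sub>R ?Y x = Q x + ?Y (?Y x)" by (subst eq) simp
  then have "Q x = ?Y x + ?Y x - ?Y (?Y x)" by (simp add: scaleR_2)
  moreover have "?Y (x - ?Y x) = ?Y x - ?Y (?Y x)"
    using adjoint_pair_linear(2)[OF hilb hilb sqrt_compl_sa] x Yx by blast
  ultimately show ?thesis by simp
qed

end

lemma sqrt_compl_intertwine:
  assumes "sa_contraction H Q" "sa_contraction K Q'" and W: "adjoint_pair H K W W'"
    and bdd: "\<And>x. x \<in> carr H \<Longrightarrow> norm (W x) \<le> c * norm x"
    and comm: "\<And>x. x \<in> carr H \<Longrightarrow> W (Q x) = Q' (W x)" and x: "x \<in> carr H"
  shows "W (sqrt_compl Q x) = sqrt_compl Q' (W x)"
proof -
  interpret H: sa_contraction H Q by fact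
  interpret K: sa_contraction K Q' by fact
  have Wx: "W x \<in> carr K" using adjoint_pairD[OF W] x by blast
  have "(\<lambda>n. W (sqrt_iter Q n x) - W (sqrt_compl Q x)) \<longlonglongrightarrow> 0"
  proof (rule Lim_null_comparison)
    show "\<forall>\<^sub>F n in sequentially. norm (W (sqrt_iter Q n x) - W (sqrt_compl Q x)) \<le> c * norm (sqrt_iter Q n x - sqrt_compl Q x)"
      using bdd adjoint_pair_linear(2)[OF H.hilb K.hilb W] H.sqrt_iter_in[OF x] H.sqrt_compl_lim(2)[OF x]
      by (auto simp flip: adjoint_pair_linear(2)[OF H.hilb K.hilb W])
    have "(\<lambda>n. c * norm (sqrt_iter Q n x - sqrt_compl Q x)) \<longlonglongrightarrow> c * 0"
      using H.sqrt_compl_lim(1)[OF x] by (intro tendsto_mult tendsto_const tendsto_norm_zero LIM_zero)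
    then show "(\<lambda>n. c * norm (sqrt_iter Q n x - sqrt_compl Q x)) \<longlonglongrightarrow> 0" by simp
  qed
  then have "(\<lambda>n. W (sqrt_iter Q n x)) \<longlonglongrightarrow> W (sqrt_compl Q x)" by (rule LIM_zero_cancel)
  moreover have "W (sqrt_iter Q n x) = sqrt_iter Q' n (W x)" for n
    using sqrt_iter_intertwine[OF H.hilb K.hilb W H.Q_sa K.Q_sa comm x] by simp
  moreover have "(\<lambda>n. sqrt_iter Q' n (W x)) \<longlonglongrightarrow> sqrt_compl Q' (W x)"
    by (rule K.sqrt_compl_lim(1)[OF Wx])
  ultimately show ?thesis using LIMSEQ_unique by auto
qed

subsection \<open>Boundedness of adjointable maps\<close>

text \<open>For unit vectors x the values <T x, y> = <x, S y> are bounded by norm (S y), pointwise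
  in y. A gliding hump makes this uniform: were T unbounded, a convergent series of signed humps in
  K would produce a point l where these values are unbounded.\<close>

lemma adjoint_pair_bounded:
  assumes "cs_hilbert_module H" "cs_hilbert_module K" and T: "adjoint_pair H K T S"
  obtains c where "c > 0" and "\<And>x. x \<in> carr H \<Longrightarrow> norm (T x) \<le> c * norm x"
proof (rule ccontr)
  interpret H: cs_hilbert_module H by fact
  interpret K: cs_hilbert_module K by fact
  note hil = H.hilbert_module_axioms K.hilbert_module_axioms
  note D = adjoint_pairD[OF T]
  assume "\<not> thesis"
  then have unb: "\<exists>x\<in>carr H. norm (T x) > c * norm x" if "c > 0" for c
    using that \<open>\<And>c. 0 < c \<Longrightarrow> (\<And>x. x \<in> carr H \<Longrightarrow> norm (T x) \<le> c * norm x) \<Longrightarrow> thesis\<close>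
    by (meson not_le)
  \<comment> \<open>The growth 4^n has to beat the hump sizes 3^(-n) used below: the product (4/3)^n
    is unbounded, while all humps after the n-th add up to only half of it.\<close>
  have "\<exists>x\<in>carr H. norm x = 1 \<and> norm (T x) \<ge> 4 ^ n" for n
  proof -
    obtain x where x: "x \<in> carr H" "norm (T x) > 4 ^ n * norm x" using unb[of "4 ^ n"] by auto
    then have "x \<noteq> 0" using adjoint_pair_linear(5)[OF hil T] by auto
    with x show ?thesis
      by (intro bexI[of _ "(1 / norm x) *\<^sub>R x"])
        (auto simp: adjoint_pair_linear(3)[OF hil T] field_simps)
  qed
  then obtain x where x: "\<And>n. x n \<in> carr H" "\<And>n. norm (x n) = 1" "\<And>n. norm (T (x n)) \<ge> 4 ^ n"
    by metis
  define f where "f n y = ip K (T (x n)) y" for n y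
  have Tx0: "norm (T (x n)) > 0" for n
    using x(3)[of n] zero_less_power[of "4::real" n] by linarith
  define z where "z n = ((1/3) ^ n / norm (T (x n))) *\<^sub>R T (x n)" for n
  have z: "z n \<in> carr K" "norm (z n) = (1/3) ^ n" "norm (f n (z n)) = (1/3) ^ n * norm (T (x n))" for n
    using D(1,2) x(1) Tx0[of n] by (auto simp: z_def f_def K.ip_scaleR K.norm_ip_self power2_eq_square)
  \<comment> \<open>The sign is chosen so that \<open>f n\<close> stays large at the new point: the
    values at u + z and u - z differ by twice \<open>f n (z n)\<close>, so one of them is at least
    as large as \<open>f n (z n)\<close>.\<close>
  define y where "y = rec_nat 0 (\<lambda>n u. if norm (f n (u + z n)) \<ge> norm (f n (u - z n)) then u + z n else u - z n)"
  have y_Suc: "y (Suc n) = (if norm (f n (y n + z n)) \<ge> norm (f n (y n - z n)) then y n + z n else y n - z n)" for n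
    by (simp add: y_def)
  have y_in: "y n \<in> carr K" for n
  proof (induction n)
    case 0 show ?case by (simp add: y_def)
  qed (use z in \<open>auto simp: y_Suc\<close>)
  have y_step: "norm (y (Suc n) - y n) = (1/3) ^ n" for n
    using z by (auto simp: y_Suc)
  have y_big: "norm (f n (y (Suc n))) \<ge> (1/3) ^ n * norm (T (x n))" for n
  proof -
    have "2 *\<^sub>R f n (z n) = f n (y n + z n) - f n (y n - z n)"
      unfolding f_def using D x(1) z(1) y_in by (simp add: K.ip_simps scaleR_2)
    then have "2 * norm (f n (z n)) = norm (f n (y n + z n) - f n (y n - z n))"
      by (metis norm_scaleR abs_numeral)
    also have "\<dots> \<le> norm (f n (y n + z n)) + norm (f n (y n - z n))" by (rule norm_triangle_ineq4)
    finally show ?thesis unfolding z(3) y_Suc by auto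
  qed
  \<comment> \<open>The bound is the closed form of the geometric sum of 3^(-k) over n < k <
    m.\<close>
  have y_diff: "norm (y m - y (Suc n)) \<le> ((1/3) ^ n - 3 * (1/3) ^ m) / 2" if "Suc n \<le> m" for m n
    using that
  proof (induction m rule: dec_induct)
    case (step m)
    then show ?case using y_step[of m] norm_triangle_ineq[of "y (Suc m) - y m" "y m - y (Suc n)"] by simp
  qed simp
  have y_diff': "norm (y m - y (Suc n)) \<le> (1/3) ^ n / 2" if "Suc n \<le> m" for m n
    by (rule order_trans[OF y_diff[OF that]]) auto
  have "Cauchy y"
    unfolding Cauchy_altdef2
  proof (intro allI impI)
    fix e :: real assume "e > 0"
    then obtain n where n: "(1/3::real) ^ n < e" using real_arch_pow_inv[of e "1/3"] by auto
    show "\<exists>N. \<forall>m\<ge>N. dist (y m) (y N) < e"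
    proof (intro exI allI impI)
      fix m assume "Suc n \<le> m"
      from y_diff'[OF this] show "dist (y m) (y (Suc n)) < e"
        unfolding dist_norm using n by (smt (verit) zero_less_power zero_less_divide_1_iff field_sum_of_halves)
    qed
  qed
  then obtain l where l: "l \<in> carr K" "y \<longlonglongrightarrow> l"
    using completeE[OF K.complete_carr] y_in by metis
  have l_diff: "norm (l - y (Suc n)) \<le> (1/3) ^ n / 2" for n
  proof (rule LIMSEQ_le_const2)
    show "(\<lambda>m. norm (y m - y (Suc n))) \<longlonglongrightarrow> norm (l - y (Suc n))"
      by (intro tendsto_intros l)
  qed (use y_diff' in blast)
  have "(4/3) ^ n / 2 \<le> norm (S l)" for n
  proof -
    have "norm (f n (l - y (Suc n))) \<le> norm (T (x n)) * norm (l - y (Suc n))"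
      unfolding f_def using D(1) x(1) l(1) y_in by (intro K.Cauchy_Schwarz) auto
    also have "\<dots> \<le> norm (T (x n)) * ((1/3) ^ n / 2)" using l_diff by (intro mult_left_mono) auto
    finally have 1: "norm (f n (l - y (Suc n))) \<le> (1/3) ^ n * norm (T (x n)) / 2" by (simp add: mult_ac)
    have "f n (l - y (Suc n)) = f n l - f n (y (Suc n))"
      unfolding f_def using D x(1) l(1) y_in by (simp add: K.ip_diff)
    then have "norm (f n l) \<ge> norm (f n (y (Suc n))) - norm (f n (l - y (Suc n)))"
      by (metis norm_minus_commute norm_triangle_ineq2 add_diff_cancel_left' diff_diff_eq2 norm_triangle_sub diff_le_eq add.commute)
    with 1 y_big[of n] have 2: "norm (f n l) \<ge> (1/3) ^ n * norm (T (x n)) / 2" by linarith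
    have "(4/3) ^ n = (1/3) ^ n * (4::real) ^ n" by (simp flip: power_mult_distrib)
    also have "\<dots> \<le> (1/3) ^ n * norm (T (x n))" using x(3) by (intro mult_left_mono) auto
    finally have "(4/3) ^ n / 2 \<le> norm (f n l)" using 2 by linarith
    also have "f n l = ip H (x n) (S l)" unfolding f_def using D x(1) l(1) by simp
    also have "norm \<dots> \<le> norm (S l)" using H.Cauchy_Schwarz[of "x n" "S l"] D x l(1) by simp
    finally show ?thesis .
  qed
  moreover obtain n where "(4/3::real) ^ n > 2 * norm (S l)" using real_arch_pow[of "4/3" "2 * norm (S l)"] by auto
  ultimately show False by (smt (verit) field_sum_of_halves)
qed

subsection \<open>Positive operators and their square roots\<close>

text \<open>Positivity is expressed by \<open>norm (c - P) \<le> c\<close>, which is manifestly closed under sums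
  and makes the iteration above applicable to \<open>P / c = 1 - (1 - P / c)\<close>.\<close>

definition pos_bound :: "('a, 'h::real_normed_vector) hmod \<Rightarrow> real \<Rightarrow> ('h \<Rightarrow> 'h) \<Rightarrow> bool" where
  "pos_bound H c P \<longleftrightarrow> c > 0 \<and> adjoint_pair H H P P \<and> (\<forall>x\<in>carr H. norm (c *\<^sub>R x - P x) \<le> c * norm x)"

text \<open>With Q = 1 - P/c, \<open>sqrt_compl\<close> gives 1 - sqrt (P/c), so this is sqrt c
  times the root of P/c.\<close>

definition pos_sqrt :: "real \<Rightarrow> ('h::real_normed_vector \<Rightarrow> 'h) \<Rightarrow> 'h \<Rightarrow> 'h" where
  "pos_sqrt c P x = sqrt c *\<^sub>R (x - sqrt_compl (\<lambda>x. x - (1/c) *\<^sub>R P x) x)"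

lemma pos_bound_contraction:
  assumes "cs_hilbert_module H" "pos_bound H c P"
  shows "sa_contraction H (\<lambda>x. x - (1/c) *\<^sub>R P x)"
proof -
  interpret cs_hilbert_module H by fact
  have c: "c > 0" and sa: "adjoint_pair H H P P"
    and le: "\<And>x. x \<in> carr H \<Longrightarrow> norm (c *\<^sub>R x - P x) \<le> c * norm x"
    using assms(2) by (auto simp: pos_bound_def)
  note D = adjoint_pairD[OF sa]
  show ?thesis
  proof unfold_locales
    show "adjoint_pair H H (\<lambda>x. x - (1/c) *\<^sub>R P x) (\<lambda>x. x - (1/c) *\<^sub>R P x)"
      unfolding adjoint_pair_def by (auto simp: ip_simps D)
    fix x assume x: "x \<in> carr H"
    have "x - (1/c) *\<^sub>R P x = (1/c) *\<^sub>R (c *\<^sub>R x - P x)" using c by (simp add: scaleR_diff_right)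
    then have "norm (x - (1/c) *\<^sub>R P x) = (1/c) * norm (c *\<^sub>R x - P x)" using c by simp
    also have "\<dots> \<le> (1/c) * (c * norm x)" using le[OF x] c by (intro mult_left_mono) auto
    finally show "norm (x - (1/c) *\<^sub>R P x) \<le> norm x" using c by simp
  qed
qed

lemma
  assumes "cs_hilbert_module H" "pos_bound H c P"
  shows pos_sqrt_square: "x \<in> carr H \<Longrightarrow> pos_sqrt c P (pos_sqrt c P x) = P x"
    and pos_bound_pos_sqrt: "pos_bound H (sqrt c) (pos_sqrt c P)"
proof -
  have c: "c > 0" and sa: "adjoint_pair H H P P" using assms(2) by (auto simp: pos_bound_def)
  interpret sa_contraction H "\<lambda>x. x - (1/c) *\<^sub>R P x" by (rule pos_bound_contraction[OF assms])
  define Y where "Y = sqrt_compl (\<lambda>x. x - (1/c) *\<^sub>R P x)"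
  have Y_sa: "adjoint_pair H H Y Y" unfolding Y_def by (rule sqrt_compl_sa)
  have Y_sq: "(x - Y x) - Y (x - Y x) = (1/c) *\<^sub>R P x" if "x \<in> carr H" for x
    using sqrt_compl_square[OF that] unfolding Y_def by simp
  have Y_le: "norm (Y x) \<le> norm x" if "x \<in> carr H" for x
    using norm_sqrt_compl[OF that] unfolding Y_def .
  note D = adjoint_pairD[OF Y_sa] and L = adjoint_pair_linear[OF hilb hilb Y_sa]
  have ps: "pos_sqrt c P = (\<lambda>x. sqrt c *\<^sub>R (x - Y x))" by (simp add: fun_eq_iff pos_sqrt_def Y_def)
  { fix x assume x: "x \<in> carr H"
    have "pos_sqrt c P (pos_sqrt c P x) = (sqrt c * sqrt c) *\<^sub>R ((x - Y x) - Y (x - Y x))"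
      unfolding ps using x by (simp add: L(3) D flip: scaleR_diff_right)
    then show "pos_sqrt c P (pos_sqrt c P x) = P x" using c by (simp add: Y_sq x) }
  show "pos_bound H (sqrt c) (pos_sqrt c P)"
    unfolding pos_bound_def
  proof (intro conjI ballI)
    show "sqrt c > 0" using c by simp
    show "adjoint_pair H H (pos_sqrt c P) (pos_sqrt c P)"
      unfolding ps adjoint_pair_def by (auto simp: ip_simps D)
    fix x assume x: "x \<in> carr H"
    have "sqrt c *\<^sub>R x - pos_sqrt c P x = sqrt c *\<^sub>R Y x" unfolding ps by (simp add: scaleR_diff_right)
    then show "norm (sqrt c *\<^sub>R x - pos_sqrt c P x) \<le> sqrt c * norm x" using Y_le[OF x] c by simp
  qed
qed

text \<open>The same \<open>c\<close> is required on both sides because the iteration is run on P/c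
  and P'/c. Boundedness of \<open>W\<close> is needed to pass to the limit and comes from
  \<open>adjoint_pair_bounded\<close>.\<close>

lemma pos_sqrt_intertwine:
  assumes H: "cs_hilbert_module H" "pos_bound H c P" and K: "cs_hilbert_module K" "pos_bound K c P'"
    and W: "adjoint_pair H K W W'" and comm: "\<And>x. x \<in> carr H \<Longrightarrow> W (P x) = P' (W x)" and x: "x \<in> carr H"
  shows "W (pos_sqrt c P x) = pos_sqrt c P' (W x)"
proof -
  interpret H: sa_contraction H "\<lambda>x. x - (1/c) *\<^sub>R P x" by (rule pos_bound_contraction[OF H])
  interpret K: sa_contraction K "\<lambda>x. x - (1/c) *\<^sub>R P' x" by (rule pos_bound_contraction[OF K])
  note L = adjoint_pair_linear[OF H.hilb K.hilb W]
  have P: "P x \<in> carr H" if "x \<in> carr H" for x using H(2) that adjoint_pairD by (auto simp: pos_bound_def)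
  obtain d where d: "\<And>x. x \<in> carr H \<Longrightarrow> norm (W x) \<le> d * norm x"
    using adjoint_pair_bounded[OF H(1) K(1) W] by metis
  have "W (sqrt_compl (\<lambda>x. x - (1/c) *\<^sub>R P x) x) = sqrt_compl (\<lambda>x. x - (1/c) *\<^sub>R P' x) (W x)"
    by (rule sqrt_compl_intertwine[OF H.sa_contraction_axioms K.sa_contraction_axioms W d _ x])
      (auto simp: L P comm)
  then show ?thesis
    unfolding pos_sqrt_def using H.sqrt_compl_lim(2)[OF x] x by (simp add: L)
qed

subsection \<open>Positivity in a C*-algebra\<close>

definition self_hmod :: "('a::cstar_algebra, 'a) hmod" where
  "self_hmod = \<lparr>carr = UNIV, ip = (\<lambda>x y. star x * y), act = (*)\<rparr>"

lemma self_hmod_simps [simp]: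
  "carr self_hmod = UNIV" "ip self_hmod x y = star x * y" "act self_hmod = (*)"
  by (auto simp: self_hmod_def)

interpretation self: cs_hilbert_module "self_hmod :: ('a::cstar_algebra, 'a) hmod"
proof
  show "submodule self_hmod (carr self_hmod)" by (simp add: submodule_def)
  show "complete (carr (self_hmod :: ('a, 'a) hmod))" by (simp add: complete_UNIV)
next
  fix x y :: 'a
  show "norm (ip self_hmod x y) \<le> norm x * norm y" using norm_mult_ineq[of "star x" y] by simp
  show "ip self_hmod x x = 0 \<Longrightarrow> x = 0" using cstar_identity[of x] by simp
qed (auto simp: algebra_simps mult_scaleC_left mult_scaleC_right star_mult star_star cstar_positive_def cstar_identity)

section \<open>Positive adjointable maps of the algebra, regarded as a module over itself\<close>

abbreviation apair :: "('a::cstar_algebra \<Rightarrow> 'a) \<Rightarrow> ('a \<Rightarrow> 'a) \<Rightarrow> bool" where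
  "apair \<equiv> adjoint_pair self_hmod self_hmod"

lemma apair_iff: "apair T S \<longleftrightarrow> (\<forall>x y. star (T x) * y = star x * S y)"
  by (auto simp: adjoint_pair_def)

lemma apair_sym: "apair T S \<Longrightarrow> apair S T"
  by (rule adjoint_pair_sym[OF self.hilbert_module_axioms self.hilbert_module_axioms])

lemma apair_linear:
  assumes "apair T S"
  shows "T (x + y) = T x + T y" "T (x - y) = T x - T y" "T (r *\<^sub>R x) = r *\<^sub>R T x" "T (- x) = - T x" "T 0 = 0"
  using adjoint_pair_linear[OF self.hilbert_module_axioms self.hilbert_module_axioms assms] by auto

lemma
  assumes "apair T S" "apair T' S'"
  shows apair_add: "apair (\<lambda>x. T x + T' x) (\<lambda>x. S x + S' x)"
    and apair_diff: "apair (\<lambda>x. T x - T' x) (\<lambda>x. S x - S' x)"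
    and apair_comp: "apair (\<lambda>x. T (T' x)) (\<lambda>x. S' (S x))"
  using assms unfolding apair_iff by (auto simp: star_add star_diff algebra_simps)

lemma
  assumes "apair T S"
  shows apair_scaleR: "apair (\<lambda>x. r *\<^sub>R T x) (\<lambda>x. r *\<^sub>R S x)"
    and apair_scaleC: "apair (\<lambda>x. c *\<^sub>C T x) (\<lambda>x. cnj c *\<^sub>C S x)"
  using assms unfolding apair_iff
  by (auto simp: star_scaleR star_scaleC mult_scaleC_left mult_scaleC_right)

lemma apair_id: "apair (\<lambda>x. x) (\<lambda>x. x)"
  by (simp add: apair_iff)

lemma apair_mult_left: "apair (\<lambda>x. a * x) (\<lambda>x. star a * x)"
  by (simp add: apair_iff star_mult mult.assoc)

lemma apair_square_zero:
  assumes "apair f f" "f (f x) = 0"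
  shows "f x = 0"
proof -
  have "star (f x) * f x = star x * f (f x)" using assms(1) by (simp add: apair_iff)
  then show ?thesis using assms(2) cstar_identity[of "f x"] by simp
qed

text \<open>These are the positive elements of the multiplier algebra. The bound is existentially
  quantified, since it changes under sums and multiples.\<close>

definition mult_pos :: "('a::cstar_algebra \<Rightarrow> 'a) \<Rightarrow> bool" where
  "mult_pos f \<longleftrightarrow> (\<exists>c. pos_bound self_hmod c f)"

lemma mult_posI: "\<lbrakk>apair f f; c > 0; \<And>x. norm (c *\<^sub>R x - f x) \<le> c * norm x\<rbrakk> \<Longrightarrow> mult_pos f"
  by (auto simp: mult_pos_def pos_bound_def)

lemma mult_pos_apair: "mult_pos f \<Longrightarrow> apair f f"
  by (auto simp: mult_pos_def pos_bound_def)

lemma mult_pos_add: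
  assumes "mult_pos f" "mult_pos g"
  shows "mult_pos (\<lambda>x. f x + g x)"
proof -
  obtain c d where *: "c > 0" "d > 0" "\<And>x. norm (c *\<^sub>R x - f x) \<le> c * norm x" "\<And>x. norm (d *\<^sub>R x - g x) \<le> d * norm x"
    using assms by (auto simp: mult_pos_def pos_bound_def)
  show ?thesis
  proof (rule mult_posI[where c = "c + d"])
    show "apair (\<lambda>x. f x + g x) (\<lambda>x. f x + g x)" by (rule apair_add[OF assms[THEN mult_pos_apair]])
    fix x
    have "(c + d) *\<^sub>R x - (f x + g x) = (c *\<^sub>R x - f x) + (d *\<^sub>R x - g x)" by (simp add: algebra_simps)
    then show "norm ((c + d) *\<^sub>R x - (f x + g x)) \<le> (c + d) * norm x"
      using norm_triangle_ineq[of "c *\<^sub>R x - f x" "d *\<^sub>R x - g x"] *(3,4)[of x]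
      by (simp only: distrib_right)
  qed (use * in simp)
qed

lemma mult_pos_scaleR:
  assumes "mult_pos f" "r > 0"
  shows "mult_pos (\<lambda>x. r *\<^sub>R f x)"
proof -
  obtain c where *: "c > 0" "\<And>x. norm (c *\<^sub>R x - f x) \<le> c * norm x"
    using assms by (auto simp: mult_pos_def pos_bound_def)
  show ?thesis
  proof (rule mult_posI[where c = "r * c"])
    show "apair (\<lambda>x. r *\<^sub>R f x) (\<lambda>x. r *\<^sub>R f x)" by (rule apair_scaleR[OF mult_pos_apair[OF assms(1)]])
    fix x
    have "(r * c) *\<^sub>R x - r *\<^sub>R f x = r *\<^sub>R (c *\<^sub>R x - f x)" by (simp add: algebra_simps)
    then show "norm ((r * c) *\<^sub>R x - r *\<^sub>R f x) \<le> r * c * norm x"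
      using *(2)[of x] assms(2) by simp
  qed (use * assms in simp)
qed

text \<open>The last clause makes roots of commuting maps commute, which is what
  \<open>norm_le_sum_squares\<close> asks for.\<close>

lemma mult_pos_sqrt:
  assumes "mult_pos f"
  obtains s where "mult_pos s" "apair s s" "\<forall>x. s (s x) = f x"
    "\<forall>g g'. apair g g' \<longrightarrow> (\<forall>x. g (f x) = f (g x)) \<longrightarrow> (\<forall>x. g (s x) = s (g x))"
proof -
  obtain c where c: "pos_bound self_hmod c f" using assms by (auto simp: mult_pos_def)
  note cs = self.cs_hilbert_module_axioms
  have "mult_pos (pos_sqrt c f)" using pos_bound_pos_sqrt[OF cs c] by (auto simp: mult_pos_def)
  then show ?thesis
    by (rule that)
      (use pos_sqrt_square[OF cs c] pos_sqrt_intertwine[OF cs c cs c] mult_pos_apair[OF \<open>mult_pos (pos_sqrt c f)\<close>] in auto)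
qed

text \<open>For commuting selfadjoint \<open>r\<close> and \<open>s\<close> the operators \<open>u = r + i s\<close> and \<open>v = r - i s\<close> both satisfy
  \<open>u* u = v* v = r\<^sup>2 + s\<^sup>2\<close>, and \<open>r = (u + v) / 2\<close>.\<close>

lemma norm_le_sum_squares:
  assumes r: "apair r r" and s: "apair s s" and comm: "\<And>x. r (s x) = s (r x)"
  shows "(norm (r x))\<^sup>2 \<le> norm x * norm (r (r x) + s (s x))"
proof -
  define B where "B = norm x * norm (r (r x) + s (s x))"
  have B: "B \<ge> 0" by (simp add: B_def)
  \<comment> \<open>Used for c = i and c = -i. The cross terms cancel because c is purely imaginary
    and r, s commute.\<close>
  have le: "norm (r x + c *\<^sub>C s x) \<le> sqrt B" if c: "cnj c = - c" "c * cnj c = 1" for c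
  proof -
    have cc: "cnj c *\<^sub>C c *\<^sub>C y = y" "c *\<^sub>C cnj c *\<^sub>C y = y" for y :: 'a
      using c(2) scaleR_scaleC[of 1 y] by (simp_all add: scaleC_scaleC mult.commute[of "cnj c" c])
    have e: "star (r x) * y = star x * r y" "star (s x) * y = star x * s y" for y
      using r s by (auto simp: apair_iff)
    have 1: "star (r x + c *\<^sub>C s x) * (r x + c *\<^sub>C s x)
        = star x * r (r x) + c *\<^sub>C (star x * r (s x)) + cnj c *\<^sub>C (star x * s (r x)) + star x * s (s x)"
      by (simp add: star_add star_scaleC distrib_left distrib_right mult_scaleC_left mult_scaleC_right e scaleC_add_right cc)
    have 2: "c *\<^sub>C (star x * r (s x)) + cnj c *\<^sub>C (star x * s (r x)) = 0"
      using scaleC_add_left[of c "cnj c" "star x * s (r x)"] scaleR_scaleC[of 0 "star x * s (r x)"] c(1)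
      by (simp add: comm)
    have "star (r x + c *\<^sub>C s x) * (r x + c *\<^sub>C s x) = star x * (r (r x) + s (s x))"
      unfolding 1 using 2 by (simp add: distrib_left add.assoc)
    then have "(norm (r x + c *\<^sub>C s x))\<^sup>2 \<le> B"
      unfolding B_def by (metis cstar_identity norm_mult_ineq norm_star)
    then show ?thesis by (rule real_le_rsqrt)
  qed
  have "(r x + \<i> *\<^sub>C s x) + (r x + (- \<i>) *\<^sub>C s x) = 2 *\<^sub>R r x"
    using scaleC_add_left[of \<i> "- \<i>" "s x"] scaleR_scaleC[of 0 "s x"] by (simp add: scaleR_2)
  then have "2 * norm (r x) \<le> norm (r x + \<i> *\<^sub>C s x) + norm (r x + (- \<i>) *\<^sub>C s x)"
    by (metis norm_triangle_ineq norm_scaleR abs_numeral)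
  also have "\<dots> \<le> 2 * sqrt B" using le[of \<i>] le[of "- \<i>"] by simp
  finally have "norm (r x) \<le> sqrt B" by simp
  then have "(norm (r x))\<^sup>2 \<le> (sqrt B)\<^sup>2" by (intro power_mono) auto
  then show ?thesis using B by (simp add: B_def)
qed

text \<open>Scale s to a contraction s'. Then 1 - s'^2 satisfies the norm criterion trivially and
  has a root r, and r^2 + s'^2 = 1 makes r a contraction. Hence norm (1 - s'^2) = norm (r^2) <= 1,
  the criterion for s'^2 itself.\<close>

lemma mult_pos_square:
  assumes s: "apair s s"
  shows "mult_pos (\<lambda>x. s (s x))"
proof -
  note cs = self.cs_hilbert_module_axioms
  obtain c where c: "c > 0" "\<And>x. norm (s x) \<le> c * norm x"
    using adjoint_pair_bounded[OF cs cs s] by auto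
  define s' where "s' x = (1/c) *\<^sub>R s x" for x
  have s': "apair s' s'" unfolding s'_def by (rule apair_scaleR[OF s])
  have s'_le: "norm (s' x) \<le> norm x" for x using c by (simp add: s'_def divide_le_eq mult.commute)
  have sq: "s' (s' x) = (1/c\<^sup>2) *\<^sub>R s (s x)" for x
    by (simp add: s'_def apair_linear[OF s] power2_eq_square)
  define f where "f x = x - s' (s' x)" for x
  have f: "mult_pos f"
  proof (rule mult_posI[where c = 1])
    show "apair f f" unfolding f_def by (rule apair_diff[OF apair_id apair_comp[OF s' s']])
    show "norm (1 *\<^sub>R x - f x) \<le> 1 * norm x" for x
      using s'_le[of x] s'_le[of "s' x"] by (simp add: f_def)
  qed simp
  obtain r where "mult_pos r" and r0: "apair r r" "\<forall>x. r (r x) = f x"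
    "\<forall>g g'. apair g g' \<longrightarrow> (\<forall>x. g (f x) = f (g x)) \<longrightarrow> (\<forall>x. g (r x) = r (g x))"
    by (rule mult_pos_sqrt[OF f], rule that)
  note r = r0[rule_format]
  have "s' (r x) = r (s' x)" for x
    by (rule r(3)[OF s']) (simp add: f_def apair_linear[OF s'])
  then have "(norm (r x))\<^sup>2 \<le> norm x * norm (r (r x) + s' (s' x))" for x
    using norm_le_sum_squares[OF r(1) s'] by simp
  then have r_le: "norm (r x) \<le> norm x" for x
    by (simp add: r(2) f_def flip: power2_eq_square)
  have f_le: "norm (f x) \<le> norm x" for x
    using r_le[of x] r_le[of "r x"] by (simp add: r(2))
  show ?thesis
  proof (rule mult_posI[where c = "c\<^sup>2"])
    show "apair (\<lambda>x. s (s x)) (\<lambda>x. s (s x))" by (rule apair_comp[OF s s])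
    fix x
    have "c\<^sup>2 *\<^sub>R x - s (s x) = c\<^sup>2 *\<^sub>R f x" using c(1) by (simp add: f_def sq scaleR_diff_right)
    then show "norm (c\<^sup>2 *\<^sub>R x - s (s x)) \<le> c\<^sup>2 * norm x" using f_le by (simp add: mult_left_mono)
  qed (use c in simp)
qed

text \<open>Roots s of f and r of -f commute and satisfy s^2 + r^2 = 0, so
  \<open>norm_le_sum_squares\<close> forces s = 0.\<close>

lemma mult_pos_antisym:
  assumes f: "mult_pos f" and nf: "mult_pos (\<lambda>x. - f x)"
  shows "f x = 0"
proof -
  obtain s where "mult_pos s" and s0: "apair s s" "\<forall>x. s (s x) = f x"
    "\<forall>g g'. apair g g' \<longrightarrow> (\<forall>x. g (f x) = f (g x)) \<longrightarrow> (\<forall>x. g (s x) = s (g x))"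
    by (rule mult_pos_sqrt[OF f], rule that)
  note s = s0[rule_format]
  obtain r where "mult_pos r" and r0: "apair r r" "\<forall>x. r (r x) = - f x"
    "\<forall>g g'. apair g g' \<longrightarrow> (\<forall>x. g (- f x) = - f (g x)) \<longrightarrow> (\<forall>x. g (r x) = r (g x))"
    by (rule mult_pos_sqrt[OF nf], rule that)
  note r = r0[rule_format]
  have "s (f x) = f (s x)" for x by (metis s(2))
  then have "s (r x) = r (s x)" for x by (intro r(3)[OF s(1)]) (simp add: apair_linear[OF s(1)])
  then have "(norm (s x))\<^sup>2 \<le> norm x * norm (s (s x) + r (r x))"
    by (rule norm_le_sum_squares[OF s(1) r(1)])
  then have "s x = 0" by (simp add: s(2) r(2))
  then show ?thesis using s(2)[of x] apair_linear(5)[OF s(1)] by simp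
qed

text \<open>Since c - f = (c - f - g) + g is positive, f and c - f have commuting roots s and r with
  s^2 + r^2 = c. This bounds norm (s x)^2 by c norm (x)^2, and f = s^2.\<close>

lemma mult_pos_norm_mono:
  assumes f: "mult_pos f" and g: "mult_pos g" and c: "c > 0" "\<And>x. norm (f x + g x) \<le> c * norm x"
  shows "norm (f x) \<le> c * norm x"
proof -
  define h where "h x = c *\<^sub>R x - f x - g x" for x
  have "mult_pos h"
  proof (rule mult_posI[where c = c])
    show "apair h h" unfolding h_def
      by (rule apair_diff[OF apair_diff[OF apair_scaleR[OF apair_id] mult_pos_apair[OF f]] mult_pos_apair[OF g]])
    show "norm (c *\<^sub>R x - h x) \<le> c * norm x" for x using c(2) by (simp add: h_def add.commute)
  qed (rule c)
  from mult_pos_add[OF this g] have k: "mult_pos (\<lambda>x. c *\<^sub>R x - f x)" by (simp add: h_def)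
  obtain s where "mult_pos s" and s0: "apair s s" "\<forall>x. s (s x) = f x"
    "\<forall>g g'. apair g g' \<longrightarrow> (\<forall>x. g (f x) = f (g x)) \<longrightarrow> (\<forall>x. g (s x) = s (g x))"
    by (rule mult_pos_sqrt[OF f], rule that)
  note s = s0[rule_format]
  obtain r where "mult_pos r" and r0: "apair r r" "\<forall>x. r (r x) = c *\<^sub>R x - f x"
    "\<forall>g g'. apair g g' \<longrightarrow> (\<forall>x. g (c *\<^sub>R x - f x) = c *\<^sub>R g x - f (g x)) \<longrightarrow> (\<forall>x. g (r x) = r (g x))"
    by (rule mult_pos_sqrt[OF k], rule that)
  note r = r0[rule_format]
  have "s (f x) = f (s x)" for x by (metis s(2))
  then have "s (r x) = r (s x)" for x by (intro r(3)[OF s(1)]) (simp add: apair_linear[OF s(1)])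
  then have "(norm (s x))\<^sup>2 \<le> norm x * norm (s (s x) + r (r x))" for x
    by (rule norm_le_sum_squares[OF s(1) r(1)])
  then have sq: "(norm (s x))\<^sup>2 \<le> c * (norm x)\<^sup>2" for x
    using c(1) by (simp add: s(2) r(2) power2_eq_square mult_ac)
  have "(norm (f x))\<^sup>2 \<le> c * (norm (s x))\<^sup>2" using sq[of "s x"] by (simp add: s(2))
  also have "\<dots> \<le> c * (c * (norm x)\<^sup>2)" using sq c(1) by (intro mult_left_mono) auto
  also have "\<dots> = (c * norm x)\<^sup>2" by (simp add: power2_eq_square mult_ac)
  finally show ?thesis by (rule power2_le_imp_le) (use c in auto)
qed

text \<open>Writing X = p + i q with selfadjoint p and q, the sum of X* X and X X* is 2 (p^2 + q^2),
  a sum of squares. Neither summand is known to be positive at this stage.\<close>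

lemma mult_pos_anticommutator:
  assumes X: "apair X X'"
  shows "mult_pos (\<lambda>y. X' (X y) + X (X' y))"
proof -
  note X' = apair_sym[OF X]
  define p where "p y = (1/2) *\<^sub>R (X y + X' y)" for y
  define q where "q y = (- \<i>) *\<^sub>C ((1/2) *\<^sub>R (X y - X' y))" for y
  have p: "apair p p"
    using apair_scaleR[OF apair_add[OF X X'], of "1/2"] unfolding p_def by (simp add: add.commute)
  have q: "apair q q"
  proof -
    have "apair q (\<lambda>y. cnj (- \<i>) *\<^sub>C ((1/2) *\<^sub>R (X' y - X y)))"
      unfolding q_def by (rule apair_scaleC[OF apair_scaleR[OF apair_diff[OF X X']]])
    moreover have "cnj (- \<i>) *\<^sub>C ((1/2) *\<^sub>R (X' y - X y)) = q y" for y
    proof -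
      have "(- \<i>) *\<^sub>C z = - (\<i> *\<^sub>C z)" for z :: 'a
        using scaleC_scaleC[of "-1" \<i> z] by (simp add: scaleC_minus_one)
      then show ?thesis unfolding q_def by (simp add: scaleR_diff_right scaleC_diff_right)
    qed
    ultimately show ?thesis by simp
  qed
  \<comment> \<open>\<open>apair_linear\<close> covers real scalars only; complex homogeneity is
    read off the adjoint relation.\<close>
  have qc: "q (c *\<^sub>C y) = c *\<^sub>C q y" for c y
  proof -
    have "star (q (c *\<^sub>C y)) * z = star (c *\<^sub>C q y) * z" for z
      using q by (simp add: apair_iff star_scaleC mult_scaleC_left)
    from this[of "q (c *\<^sub>C y) - c *\<^sub>C q y"] show ?thesis
      using cstar_identity[of "q (c *\<^sub>C y) - c *\<^sub>C q y"] by (simp add: star_diff left_diff_distrib)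
  qed
  have L: "X (y + z) = X y + X z" "X (y - z) = X y - X z" "X (r *\<^sub>R y) = r *\<^sub>R X y"
    "X' (y + z) = X' y + X' z" "X' (y - z) = X' y - X' z" "X' (r *\<^sub>R y) = r *\<^sub>R X' y" for y z r
    using apair_linear[OF X] apair_linear[OF X'] by auto
  have "q (q y) = (- \<i>) *\<^sub>C (q ((1/2) *\<^sub>R (X y - X' y)))" for y
    by (subst (2) q_def) (rule qc)
  also have "\<dots> y = - ((1/4) *\<^sub>R (X (X y) - X (X' y) - X' (X y) + X' (X' y)))" for y
  proof -
    have "(- \<i>) *\<^sub>C (- \<i>) *\<^sub>C z = - z" for z :: 'a
      by (simp add: scaleC_scaleC scaleC_minus_one)
    then show ?thesis unfolding q_def by (simp add: L algebra_simps)
  qed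
  finally have qq: "q (q y) = - ((1/4) *\<^sub>R (X (X y) - X (X' y) - X' (X y) + X' (X' y)))" for y .
  have pp: "p (p y) = (1/4) *\<^sub>R (X (X y) + X (X' y) + X' (X y) + X' (X' y))" for y
    unfolding p_def by (simp add: L algebra_simps)
  have "2 *\<^sub>R (p (p y) + q (q y)) = X' (X y) + X (X' y)" for y
    unfolding pp qq by (simp add: algebra_simps flip: scaleR_add_left)
  moreover have "mult_pos (\<lambda>y. 2 *\<^sub>R (p (p y) + q (q y)))"
    by (intro mult_pos_scaleR mult_pos_add mult_pos_square p q) simp
  ultimately show ?thesis by simp
qed

text \<open>With \<open>w = - X* X = s\<^sup>2\<close> and \<open>Y = X X*\<close> positive, the operator \<open>Z = X s\<close> has \<open>Z Z* = - Y\<^sup>2\<close> and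
  \<open>Z* Z = - w\<^sup>2\<close>, whose sum is also positive.\<close>

lemma mult_pos_neg_square:
  assumes X: "apair X X'" and neg: "mult_pos (\<lambda>y. - X' (X y))"
  shows "X' (X y) = 0"
proof -
  note X' = apair_sym[OF X]
  define Y where "Y y = X (X' y)" for y
  define w where "w y = - X' (X y)" for y
  have w: "mult_pos w" using neg by (simp add: w_def[abs_def])
  have w_sa: "apair w w" by (rule mult_pos_apair[OF w])
  have Y_sa: "apair Y Y" unfolding Y_def by (rule apair_comp[OF X X'])
  obtain s where s: "apair s s" "\<And>y. s (s y) = w y" using mult_pos_sqrt[OF w] by metis
  have Z: "apair (\<lambda>y. X (s y)) (\<lambda>y. s (X' y))" by (rule apair_comp[OF X s(1)])
  have "s (X' (X (s y))) + X (s (s (X' y))) = - (w (w y) + Y (Y y))" for y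
  proof -
    have "X' (X (s y)) = - s (s (s y))" using s(2)[of "s y"] by (simp add: w_def)
    then have 1: "s (X' (X (s y))) = - w (w y)" by (simp add: apair_linear[OF s(1)] s(2))
    have "X (s (s (X' y))) = - Y (Y y)" by (simp add: s(2) w_def Y_def apair_linear[OF X])
    with 1 show ?thesis by simp
  qed
  with mult_pos_anticommutator[OF Z] have "mult_pos (\<lambda>y. - (w (w y) + Y (Y y)))" by simp
  moreover have "mult_pos (\<lambda>y. w (w y) + Y (Y y))" by (intro mult_pos_add mult_pos_square w_sa Y_sa)
  ultimately have "w (w y) + Y (Y y) = 0" for y by (rule mult_pos_antisym[rotated])
  then have "Y (Y y) = - w (w y)" for y by (simp add: eq_neg_iff_add_eq_0 add.commute)
  \<comment> \<open>Now - w^2 equals the square Y^2, so antisymmetry applies a second time and gives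
    w^2 = 0.\<close>
  then have "mult_pos (\<lambda>y. - w (w y))" using mult_pos_square[OF Y_sa] by simp
  then have "w (w y) = 0" for y by (rule mult_pos_antisym[OF mult_pos_square[OF w_sa]])
  then show ?thesis using apair_square_zero[OF w_sa] by (simp add: w_def)
qed

text \<open>Kaplansky's argument: with \<open>h = T* T\<close>, its modulus \<open>m\<close> and its negative part \<open>v\<close>, the operator
  \<open>X = T v\<close> satisfies \<open>X* X = v h v = - v\<^sup>3\<close>.\<close>

lemma mult_pos_adjoint_mult:
  assumes T: "apair T S"
  shows "mult_pos (\<lambda>x. S (T x))"
proof -
  define h where "h x = S (T x)" for x
  have h: "apair h h" unfolding h_def by (rule apair_comp[OF apair_sym[OF T] T])
  obtain m where m0: "mult_pos m" "apair m m" "\<forall>x. m (m x) = h (h x)"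
    "\<forall>g g'. apair g g' \<longrightarrow> (\<forall>x. g (h (h x)) = h (h (g x))) \<longrightarrow> (\<forall>x. g (m x) = m (g x))"
    by (rule mult_pos_sqrt[OF mult_pos_square[OF h]], rule that)
  note m = m0[rule_format]
  have hm: "h (m x) = m (h x)" for x by (rule m(4)[OF h]) simp
  \<comment> \<open>This root exhibits v^3 as a square: k commutes with v, and (k v)^2 = m v^2 = v^3
    because m acts as v on the range of v.\<close>
  obtain k where "mult_pos k" and k0: "apair k k" "\<forall>x. k (k x) = m x"
    "\<forall>g g'. apair g g' \<longrightarrow> (\<forall>x. g (m x) = m (g x)) \<longrightarrow> (\<forall>x. g (k x) = k (g x))"
    by (rule mult_pos_sqrt[OF m(1)], rule that)
  note k = k0[rule_format]
  define v where "v x = (1/2) *\<^sub>R (m x - h x)" for x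
  have v: "apair v v" unfolding v_def by (rule apair_scaleR[OF apair_diff[OF m(2) h]])
  have vm: "v (m x) = m (v x)" for x
    by (simp add: v_def hm apair_linear[OF m(2)])
  have vk: "v (k x) = k (v x)" for x by (rule k(3)[OF v]) (rule vm)
  \<comment> \<open>From (m - h)(m + h) = m^2 - h^2 = 0 one gets v (m + h) = 0, while v (m - h) = 2
    v^2. Half the sum and half the difference give the two claims.\<close>
  have vh: "v (h x) = - v (v x)" and vm': "v (m x) = v (v x)" for x
  proof -
    have "v (m x + h x) = 0"
      by (simp add: v_def hm m(3) apair_linear[OF m(2)] apair_linear[OF h])
    moreover have "v (m x - h x) = 2 *\<^sub>R v (v x)"
      by (simp add: v_def[of x] apair_linear[OF v])
    ultimately have "v (m x) + v (h x) = 0" "v (m x) - v (h x) = v (v x) + v (v x)"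
      by (simp_all add: apair_linear[OF v] scaleR_2)
    moreover have "2 *\<^sub>R v (m x) = (v (m x) + v (h x)) + (v (m x) - v (h x))" by (simp add: scaleR_2)
    ultimately have "2 *\<^sub>R v (m x) = 2 *\<^sub>R v (v x)" by (simp add: scaleR_2)
    then show 1: "v (m x) = v (v x)" by simp
    show "v (h x) = - v (v x)" using \<open>v (m x) + v (h x) = 0\<close> 1 by (simp add: eq_neg_iff_add_eq_0 add.commute)
  qed
  have kv: "apair (\<lambda>x. k (v x)) (\<lambda>x. k (v x))"
    using apair_comp[OF k(1) v] by (simp add: vk)
  have kvkv: "k (v (k (v x))) = v (v (v x))" for x
  proof -
    have "k (v (k (v x))) = v (m (v x))" by (simp only: vk k(2) vm)
    then show ?thesis by (simp only: vm')
  qed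
  have X: "apair (\<lambda>x. T (v x)) (\<lambda>x. v (S x))" by (rule apair_comp[OF T v])
  have XX: "v (S (T (v x))) = - v (v (v x))" for x using vh[of "v x"] by (simp add: h_def)
  have "mult_pos (\<lambda>x. - v (S (T (v x))))"
    using mult_pos_square[OF kv] by (simp add: kvkv XX)
  then have "v (v (v x)) = 0" for x using mult_pos_neg_square[OF X] XX by (metis neg_equal_0_iff_equal)
  then have "v (v x) = 0" for x using apair_square_zero[OF v, of "v x"] by blast
  then have "v x = 0" for x using apair_square_zero[OF v] by blast
  then have "h x = m x" for x by (simp add: v_def)
  with m(1) show ?thesis by (simp add: h_def)
qed

text \<open>Positivity of \<open>a\<close> in the sense of \<open>cstar_positive\<close> is not obviously closed under sums;
  positivity of left multiplication by \<open>a\<close> is.\<close>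

definition elt_pos :: "'a::cstar_algebra \<Rightarrow> bool" where
  "elt_pos a \<longleftrightarrow> mult_pos (\<lambda>x. a * x)"

lemma elt_pos_cstar_positive: "cstar_positive a \<Longrightarrow> elt_pos a"
  using mult_pos_adjoint_mult[OF apair_mult_left] by (auto simp: cstar_positive_def elt_pos_def mult.assoc)

lemma elt_pos_star_mult: "elt_pos (star a * a)"
  by (rule elt_pos_cstar_positive) (auto simp: cstar_positive_def)

lemma elt_pos_add: "\<lbrakk>elt_pos a; elt_pos b\<rbrakk> \<Longrightarrow> elt_pos (a + b)"
  using mult_pos_add by (auto simp: elt_pos_def distrib_right)

lemma elt_pos_scaleR: "\<lbrakk>elt_pos a; r > 0\<rbrakk> \<Longrightarrow> elt_pos (r *\<^sub>R a)"
  using mult_pos_scaleR by (auto simp: elt_pos_def)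

text \<open>The operator version applies to left multiplications. Without a unit, norm a is
  recovered by evaluating at \<open>star a\<close>. Working with c strictly above norm (a + b)
  ensures c > 0 even if a + b = 0.\<close>

lemma norm_le_norm_add:
  assumes "elt_pos a" "elt_pos b"
  shows "norm a \<le> norm (a + b)"
proof (rule dense_ge)
  fix c assume c: "norm (a + b) < c"
  then have c0: "c > 0" using norm_ge_zero[of "a + b"] by linarith
  have "norm (a * x + b * x) \<le> c * norm x" for x
  proof -
    have "norm (a * x + b * x) \<le> norm (a + b) * norm x"
      using norm_mult_ineq[of "a + b" x] by (simp add: distrib_right)
    also have "\<dots> \<le> c * norm x" using c by (intro mult_right_mono) auto
    finally show ?thesis .
  qed
  from mult_pos_norm_mono[OF assms[unfolded elt_pos_def] c0 this]
  have "norm (a * star a) \<le> c * norm (star a)" .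
  then have "norm a * norm a \<le> c * norm a"
    using cstar_identity[of "star a"] by (simp add: star_star power2_eq_square)
  then show "norm a \<le> c" using c0 by (cases "norm a = 0") auto
qed

section \<open>The Cauchy-Schwarz inequality in every Hilbert module\<close>

sublocale hilbert_module \<subseteq> cs_hilbert_module
proof
  fix x y assume x: "x \<in> carr H" and y: "y \<in> carr H"
  show "norm (ip H x y) \<le> norm x * norm y"
  proof (cases "y = 0")
    case True then show ?thesis using x by simp
  next
    case False
    define a where "a = ip H y x"
    define t where "t = 1 / (norm y)\<^sup>2"
    have t: "t > 0" using False by (simp add: t_def)
    have sa: "star a = ip H x y" using x y by (simp add: a_def ip_star)
    \<comment> \<open>A substitute for the projection of x to the submodule generated by y: <y, y>
      need not be invertible, so its inverse is replaced by the scalar 1 / norm (y)^2.\<close>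
    define z where "z = act H y (t *\<^sub>R a)"
    have z: "z \<in> carr H" using y by (simp add: z_def)
    \<comment> \<open>Moving the cross terms to the left leaves two positive summands there, so
      monotonicity of the norm discards the first. On the right only the norm of a* <y, y> a is
      needed, with no order estimate for it.\<close>
    have "ip H (x - z) (x - z) + (2 * t) *\<^sub>R (star a * a) = ip H x x + t\<^sup>2 *\<^sub>R (star a * ip H y y * a)"
      using x y z unfolding ip_diff[OF carr_closed(6)[OF x z] x z] ip_diff_left[OF x z x] ip_diff_left[OF x z z]
      by (simp add: z_def ip_act ip_act_left star_scaleR power2_eq_square mult.assoc flip: a_def sa)
        (simp add: algebra_simps mult_2 flip: scaleR_add_left)
    then have "norm ((2 * t) *\<^sub>R (star a * a)) \<le> norm (ip H x x + t\<^sup>2 *\<^sub>R (star a * ip H y y * a))"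
      using norm_le_norm_add[OF elt_pos_scaleR[OF elt_pos_star_mult, of "2 * t" a]
          elt_pos_cstar_positive[OF ip_positive[OF carr_closed(6)[OF x z]]]] t
      by (simp add: add.commute)
    also have "\<dots> \<le> norm (ip H x x) + norm (t\<^sup>2 *\<^sub>R (star a * ip H y y * a))" by (rule norm_triangle_ineq)
    also have "\<dots> = (norm x)\<^sup>2 + t\<^sup>2 * norm (star a * ip H y y * a)" by (simp add: norm_ip_self x)
    also have "norm (star a * ip H y y * a) \<le> norm a * (norm y)\<^sup>2 * norm a"
      using norm_mult_ineq[of "star a * ip H y y" a] norm_mult_ineq[of "star a" "ip H y y"]
      by (simp add: norm_ip_self y) (meson mult_right_mono norm_ge_zero order_trans)
    finally have "2 * t * (norm a)\<^sup>2 \<le> (norm x)\<^sup>2 + t\<^sup>2 * (norm a * (norm y)\<^sup>2 * norm a)"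
      using t by (simp add: cstar_identity)
    also have "t\<^sup>2 * (norm a * (norm y)\<^sup>2 * norm a) = t * (norm a)\<^sup>2"
      using False by (simp add: t_def power2_eq_square)
    finally have "t * (norm a)\<^sup>2 \<le> (norm x)\<^sup>2" by simp
    then have "(norm a)\<^sup>2 \<le> (norm x * norm y)\<^sup>2"
      using False by (simp add: t_def divide_le_eq power_mult_distrib)
    then have "norm a \<le> norm x * norm y" by (rule power2_le_imp_le) simp
    then show ?thesis using sa by (metis norm_star)
  qed
qed

subsection \<open>Uniqueness of square roots\<close>

lemma hilbert_module_cs:
  assumes "hilbert_module H"
  shows "cs_hilbert_module H"
proof -
  interpret hilbert_module H by fact
  show ?thesis by (rule cs_hilbert_module_axioms)
qed

text \<open>The form in which the order of the algebra is used for modules: a positive summand in an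
  inner product identity may be dropped.\<close>

lemma (in hilbert_module) norm_le_if_ip_add:
  assumes "x \<in> carr H" "y \<in> carr H" "elt_pos p" "ip H x x + p = ip H y y"
  shows "norm x \<le> norm y"
proof -
  have "norm (ip H x x) \<le> norm (ip H x x + p)"
    using assms ip_positive elt_pos_cstar_positive norm_le_norm_add by blast
  then have "(norm x)\<^sup>2 \<le> (norm y)\<^sup>2" using assms by (simp add: norm_ip_self)
  then show ?thesis by (rule power2_le_imp_le) simp
qed

lemma (in hilbert_module) elt_pos_ip_self: "x \<in> carr H \<Longrightarrow> elt_pos (ip H x x)"
  by (rule elt_pos_cstar_positive[OF ip_positive])

lemma adjoint_norm_bound:
  assumes "hilbert_module H" "hilbert_module K" and T: "adjoint_pair H K T S"
    and c: "c \<ge> 0" and bd: "\<And>x. x \<in> carr H \<Longrightarrow> norm (T x) \<le> c * norm x" and y: "y \<in> carr K"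
  shows "norm (S y) \<le> c * norm y"
proof (cases "S y = 0")
  case False
  interpret H: hilbert_module H by fact
  interpret K: hilbert_module K by fact
  note D = adjoint_pairD[OF T]
  have "norm (S y) * norm (S y) = norm (ip K (T (S y)) y)"
    using D y H.norm_ip_self[of "S y"] by (simp add: power2_eq_square)
  also have "\<dots> \<le> norm (T (S y)) * norm y" using D(1,2) y by (intro K.Cauchy_Schwarz) auto
  also have "\<dots> \<le> (c * norm (S y)) * norm y" using bd D y by (intro mult_right_mono) auto
  finally show ?thesis using False by (simp add: mult_ac)
qed (use c in simp)

text \<open>The scheme of \<open>mult_pos_square\<close>: Q = S T / c^2 is a contraction, so 1 - Q
  has a root s. The identity <s x, s x> + <T x, T x> / c^2 = <x, x> makes s a contraction, and c^2 -
  S T = c^2 s^2.\<close>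

lemma pos_bound_adjoint_mult:
  assumes H: "hilbert_module H" and K: "hilbert_module K" and T: "adjoint_pair H K T S"
    and c: "c > 0" and bd: "\<And>x. x \<in> carr H \<Longrightarrow> norm (T x) \<le> c * norm x"
  shows "pos_bound H (c\<^sup>2) (\<lambda>x. S (T x))"
proof -
  interpret H: hilbert_module H by fact
  interpret K: hilbert_module K by fact
  note D = adjoint_pairD[OF T]
  define Q where "Q x = (1/c\<^sup>2) *\<^sub>R S (T x)" for x
  have ST: "adjoint_pair H H (\<lambda>x. S (T x)) (\<lambda>x. S (T x))"
    by (rule adjoint_pair_comp[OF T adjoint_pair_sym[OF H K T]])
  have Q: "adjoint_pair H H Q Q"
    using adjoint_pairD[OF ST] unfolding Q_def adjoint_pair_def by (auto simp: H.ip_simps)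
  have Q_le: "norm (Q x) \<le> norm x" if "x \<in> carr H" for x
  proof -
    have "norm (S (T x)) \<le> c * norm (T x)"
      using adjoint_norm_bound[OF H K T _ bd] c D that by simp
    also have "\<dots> \<le> c * (c * norm x)" using bd[OF that] c by simp
    finally show ?thesis using c by (simp add: Q_def divide_le_eq power2_eq_square mult_ac)
  qed
  have pb: "pos_bound H 1 (\<lambda>x. x - Q x)"
    using Q_le adjoint_pairD[OF Q] unfolding pos_bound_def adjoint_pair_def by (auto simp: H.ip_simps)
  define s where "s = pos_sqrt 1 (\<lambda>x. x - Q x)"
  have s: "adjoint_pair H H s s" and ss: "\<And>x. x \<in> carr H \<Longrightarrow> s (s x) = x - Q x"
    using pos_bound_pos_sqrt[OF hilbert_module_cs[OF H] pb] pos_sqrt_square[OF hilbert_module_cs[OF H] pb]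
    by (auto simp: s_def pos_bound_def)
  note sD = adjoint_pairD[OF s]
  have s_le: "norm (s x) \<le> norm x" if x: "x \<in> carr H" for x
  proof (rule H.norm_le_if_ip_add)
    show "elt_pos ((1/c\<^sup>2) *\<^sub>R ip K (T x) (T x))"
      using D x c by (intro elt_pos_scaleR K.elt_pos_ip_self) auto
    have "ip H (s x) (s x) = ip H x (x - Q x)" using sD x ss by simp
    also have "\<dots> = ip H x x - (1/c\<^sup>2) *\<^sub>R ip K (T x) (T x)"
      using D x by (simp add: Q_def H.ip_simps)
    finally show "ip H (s x) (s x) + (1/c\<^sup>2) *\<^sub>R ip K (T x) (T x) = ip H x x" by simp
  qed (use sD x in auto)
  have "norm (c\<^sup>2 *\<^sub>R x - S (T x)) \<le> c\<^sup>2 * norm x" if x: "x \<in> carr H" for x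
  proof -
    have "c\<^sup>2 *\<^sub>R x - S (T x) = c\<^sup>2 *\<^sub>R s (s x)"
      using c ss[OF x] by (simp add: Q_def scaleR_diff_right)
    moreover have "norm (s (s x)) \<le> norm x" using s_le[OF x] s_le[of "s x"] sD x by simp
    ultimately show ?thesis by (simp add: mult_left_mono)
  qed
  then show ?thesis using ST c by (auto simp: pos_bound_def)
qed

section \<open>Adjoints and square roots of extensional operators\<close>

lemma adj_eq:
  assumes H: "hilbert_module H" and T: "adjoint_pair H K T S"
  shows "adj H K T = restrict S (carr K)"
  unfolding adj_def
proof (rule the_equality)
  interpret H: hilbert_module H by fact
  show "is_adjoint H K T (restrict S (carr K))"
    using T by (auto simp: is_adjoint_def adjoint_pair_def)
  fix S' assume S': "is_adjoint H K T S'"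
  show "S' = restrict S (carr K)"
  proof (rule extensionalityI[where A = "carr K"])
    show "S' \<in> extensional (carr K)" using S' by (auto simp: is_adjoint_def PiE_def)
    fix y assume y: "y \<in> carr K"
    have "S' y = S y"
      by (rule H.ip_eqI) (use S' y adjoint_pairD[OF T] in \<open>auto simp: is_adjoint_def\<close>)
    then show "S' y = restrict S (carr K) y" using y by simp
  qed auto
qed

lemma adjoint_pair_adj:
  assumes "hilbert_module H" "T \<in> adjointables H K"
  shows "adjoint_pair H K T (adj H K T)"
proof -
  obtain S where S: "is_adjoint H K T S" and T: "T \<in> carr H \<rightarrow>\<^sub>E carr K"
    using assms(2) by (auto simp: adjointables_def)
  then have "adjoint_pair H K T S" by (auto simp: is_adjoint_def adjoint_pair_def)
  with adj_eq[OF assms(1) this] show ?thesis by (auto simp: adjoint_pair_def)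
qed

lemma adjoint_pair_cong:
  assumes "\<And>x. x \<in> carr H \<Longrightarrow> T x = T' x" "\<And>y. y \<in> carr K \<Longrightarrow> S y = S' y"
  shows "adjoint_pair H K T S \<longleftrightarrow> adjoint_pair H K T' S'"
  using assms by (auto simp: adjoint_pair_def Pi_iff)

lemma adjoint_pair_restrict:
  "adjoint_pair H K (restrict T (carr H)) (restrict S (carr K)) \<longleftrightarrow> adjoint_pair H K T S"
  by (rule adjoint_pair_cong) auto

lemma adj_restrict:
  assumes "hilbert_module H" "adjoint_pair H K T S"
  shows "adj H K (restrict T (carr H)) = restrict S (carr K)"
  using adj_eq[OF assms(1), of K "restrict T (carr H)" "restrict S (carr K)"] assms(2)
  by (simp add: adjoint_pair_restrict)

lemma restrict_adjointable:
  assumes "adjoint_pair H K T S"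
  shows "restrict T (carr H) \<in> adjointables H K"
  using assms by (auto simp: adjointables_def is_adjoint_def adjoint_pair_def intro!: exI[of _ "restrict S (carr K)"])

lemma pos_bound_sqrt_facts:
  assumes H: "hilbert_module H" and P: "pos_bound H c P"
  obtains B where "pos_bound H (sqrt c) B" "adjoint_pair H H B B" "B = pos_sqrt c P"
    "\<And>x. x \<in> carr H \<Longrightarrow> B (B x) = P x" "\<And>x. x \<in> carr H \<Longrightarrow> ip H x (P x) = ip H (B x) (B x)"
proof
  show 1: "pos_bound H (sqrt c) (pos_sqrt c P)"
    by (rule pos_bound_pos_sqrt[OF hilbert_module_cs[OF H] P])
  then show 2: "adjoint_pair H H (pos_sqrt c P) (pos_sqrt c P)" by (simp add: pos_bound_def)
  fix x assume x: "x \<in> carr H"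
  show 3: "pos_sqrt c P (pos_sqrt c P x) = P x" by (rule pos_sqrt_square[OF hilbert_module_cs[OF H] P x])
  show "ip H x (P x) = ip H (pos_sqrt c P x) (pos_sqrt c P x)"
    using adjoint_pairD[OF 2] x 3 by simp
qed auto

lemma op_positive_pos_bound:
  assumes H: "hilbert_module H" and P: "pos_bound H c P"
  shows "op_positive H (restrict P (carr H))"
proof -
  obtain B where B: "adjoint_pair H H B B" "\<And>x. x \<in> carr H \<Longrightarrow> B (B x) = P x"
    using pos_bound_sqrt_facts[OF assms] by metis
  have "adj H H (restrict B (carr H)) = restrict B (carr H)"
    by (rule adj_restrict[OF H B(1)])
  then have "restrict P (carr H) = compose (carr H) (adj H H (restrict B (carr H))) (restrict B (carr H))"
    using B adjoint_pairD(1)[OF B(1)] by (auto simp: compose_def)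
  then show ?thesis
    unfolding op_positive_def using restrict_adjointable[OF B(1)] by blast
qed

lemma op_positive_ip:
  assumes H: "hilbert_module H" and S: "op_positive H S"
  obtains B where "adjoint_pair H H S S" "S \<in> extensional (carr H)" "B \<in> carr H \<rightarrow> carr H"
    "\<And>x. x \<in> carr H \<Longrightarrow> ip H x (S x) = ip H (B x) (B x)"
proof -
  obtain B where B: "B \<in> adjointables H H" "S = compose (carr H) (adj H H B) B"
    using S by (auto simp: op_positive_def)
  note BB = adjoint_pair_adj[OF H B(1)]
  have *: "adjoint_pair H H (\<lambda>x. adj H H B (B x)) (\<lambda>x. adj H H B (B x))"
    by (rule adjoint_pair_comp[OF BB adjoint_pair_sym[OF H H BB]])
  show ?thesis
  proof
    show "adjoint_pair H H S S" using * unfolding B(2) compose_def adjoint_pair_restrict .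
    show "S \<in> extensional (carr H)" by (simp add: B(2))
    show "B \<in> carr H \<rightarrow> carr H" using adjoint_pairD(1)[OF BB] by auto
    show "ip H x (S x) = ip H (B x) (B x)" if "x \<in> carr H" for x
      using adjoint_pairD[OF BB] that by (simp add: B(2) compose_def)
  qed
qed

text \<open>The constructed root A commutes with S, because S commutes with S^2 = P. For d = A - S
  this gives (A + S) d = 0; pairing with d x yields two positive terms with sum 0, so A and then S
  vanish on d x. Hence d^2 = 0, and d = 0 by selfadjointness.\<close>

lemma op_sqrt_unique:
  assumes H: "hilbert_module H" and P: "pos_bound H c P"
    and S: "op_positive H S" and SS: "\<And>x. x \<in> carr H \<Longrightarrow> S (S x) = P x"
  shows "S = restrict (pos_sqrt c P) (carr H)"
proof -
  interpret H: hilbert_module H by fact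
  note cs = H.cs_hilbert_module_axioms
  obtain A where A: "pos_bound H (sqrt c) A" "adjoint_pair H H A A" "A = pos_sqrt c P" "\<And>x. x \<in> carr H \<Longrightarrow> A (A x) = P x"
    using pos_bound_sqrt_facts[OF H P] by metis
  \<comment> \<open>A second root is taken in order to write <y, A y> as <A' y, A' y>, which is
    visibly positive and whose vanishing gives A y = 0.\<close>
  obtain A' where A': "adjoint_pair H H A' A'" "\<And>x. x \<in> carr H \<Longrightarrow> A' (A' x) = A x"
    "\<And>x. x \<in> carr H \<Longrightarrow> ip H x (A x) = ip H (A' x) (A' x)"
    using pos_bound_sqrt_facts[OF H A(1)] by metis
  obtain B where B: "adjoint_pair H H S S" "S \<in> extensional (carr H)" "B \<in> carr H \<rightarrow> carr H"
    "\<And>x. x \<in> carr H \<Longrightarrow> ip H x (S x) = ip H (B x) (B x)"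
    using op_positive_ip[OF H S] by metis
  note D = adjoint_pairD(1,2)[OF A(2)] adjoint_pairD(1,2)[OF A'(1)] adjoint_pairD(1,2)[OF B(1)]
  note L = adjoint_pair_linear[OF H H A(2)] adjoint_pair_linear[OF H H A'(1)] adjoint_pair_linear[OF H H B(1)]
  have comm: "S (A x) = A (S x)" if x: "x \<in> carr H" for x
    unfolding A(3)
  proof (rule pos_sqrt_intertwine[OF cs P cs P B(1) _ x])
    show "S (P x) = P (S x)" if "x \<in> carr H" for x
      using SS[OF that] SS[of "S x"] D that by simp
  qed
  define d where "d x = A x - S x" for x
  have d: "adjoint_pair H H d d"
    using adjoint_pairD[OF A(2)] adjoint_pairD[OF B(1)] unfolding d_def adjoint_pair_def by (auto simp: H.ip_simps)
  note dD = adjoint_pairD[OF d]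
  have d0: "d x = 0" if x: "x \<in> carr H" for x
  proof -
    let ?y = "d x"
    have y: "?y \<in> carr H" using dD x by blast
    have "A ?y + S ?y = 0" using x D by (simp add: d_def L comm SS A(4))
    then have "ip H ?y (A ?y) + ip H ?y (S ?y) = 0"
      using y D H.ip_add[of ?y "A ?y" "S ?y"] by simp
    then have sum: "ip H (A' ?y) (A' ?y) + ip H (B ?y) (B ?y) = ip H 0 0" using A'(3) B(4) y by simp
    have By: "B ?y \<in> carr H" using B(3) y by blast
    have "norm (A' ?y) \<le> norm (0::'b)"
      by (rule H.norm_le_if_ip_add[OF _ _ _ sum]) (use D y By H.elt_pos_ip_self in auto)
    then have "A ?y = 0" using A'(2)[OF y] L by simp
    with \<open>A ?y + S ?y = 0\<close> have "d ?y = 0" by (simp add: d_def)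
    then have "ip H ?y ?y = 0" using dD(3)[OF x y] dD(2)[OF y] x by simp
    then show ?thesis using H.ip_definite y by blast
  qed
  show ?thesis
    by (rule extensionalityI[where A = "carr H"]) (use B(2) d0 A(3) in \<open>auto simp: d_def\<close>)
qed

lemma op_sqrt_eq:
  assumes H: "hilbert_module H" and P: "pos_bound H c P"
  shows "op_sqrt H (restrict P (carr H)) = restrict (pos_sqrt c P) (carr H)"
  unfolding op_sqrt_def
proof (rule the_equality)
  obtain A where A: "pos_bound H (sqrt c) A" "adjoint_pair H H A A" "A = pos_sqrt c P" "\<And>x. x \<in> carr H \<Longrightarrow> A (A x) = P x"
    using pos_bound_sqrt_facts[OF assms] by metis
  show "op_positive H (restrict (pos_sqrt c P) (carr H)) \<and>
      compose (carr H) (restrict (pos_sqrt c P) (carr H)) (restrict (pos_sqrt c P) (carr H)) = restrict P (carr H)"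
    using op_positive_pos_bound[OF H A(1)] A adjoint_pairD(1)[OF A(2)]
    by (auto simp: compose_def fun_eq_iff)
  fix S assume S: "op_positive H S \<and> compose (carr H) S S = restrict P (carr H)"
  show "S = restrict (pos_sqrt c P) (carr H)"
  proof (rule op_sqrt_unique[OF assms])
    show "S (S x) = P x" if "x \<in> carr H" for x
      using S that compose_eq[OF that, of S S] by simp
  qed (use S in blast)
qed

text \<open>For an adjoint S of T this is |T|^(1/2) = (S T)^(1/4). If c bounds T, then c^2 serves as
  the constant for S T and c = sqrt (c^2) for its root |T|.\<close>

definition fourth_root :: "real \<Rightarrow> ('h::real_normed_vector \<Rightarrow> 'k) \<Rightarrow> ('k \<Rightarrow> 'h) \<Rightarrow> 'h \<Rightarrow> 'h" where
  "fourth_root c T S = pos_sqrt c (pos_sqrt (c\<^sup>2) (\<lambda>x. S (T x)))"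

lemma
  assumes H: "hilbert_module H" and K: "hilbert_module K" and T: "adjoint_pair H K T S"
    and c: "c > 0" and bd: "\<And>x. x \<in> carr H \<Longrightarrow> norm (T x) \<le> c * norm x"
  shows pos_bound_fourth_root: "pos_bound H (sqrt c) (fourth_root c T S)"
    and fourth_root_power: "x \<in> carr H \<Longrightarrow>
      fourth_root c T S (fourth_root c T S (fourth_root c T S (fourth_root c T S x))) = S (T x)"
    and sqrt_abs_eq: "sqrt_abs H K T = restrict (fourth_root c T S) (carr H)"
proof -
  have sq: "sqrt (c\<^sup>2) = c" using c by simp
  note pb = pos_bound_adjoint_mult[OF assms]
  obtain B where B: "pos_bound H c B" "adjoint_pair H H B B" "B = pos_sqrt (c\<^sup>2) (\<lambda>x. S (T x))"
    "\<And>x. x \<in> carr H \<Longrightarrow> B (B x) = S (T x)"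
    using pos_bound_sqrt_facts[OF H pb] unfolding sq by metis
  obtain A where A: "pos_bound H (sqrt c) A" "adjoint_pair H H A A" "A = pos_sqrt c B"
    "\<And>x. x \<in> carr H \<Longrightarrow> A (A x) = B x"
    using pos_bound_sqrt_facts[OF H B(1)] by metis
  have eq: "fourth_root c T S = A" by (simp add: A(3) B(3) fourth_root_def)
  show "pos_bound H (sqrt c) (fourth_root c T S)" using A(1) eq by simp
  show "fourth_root c T S (fourth_root c T S (fourth_root c T S (fourth_root c T S x))) = S (T x)" if "x \<in> carr H"
    using A(4) B(4) adjoint_pairD(1)[OF A(2)] that unfolding eq by metis
  have "compose (carr H) (adj H K T) T = restrict (\<lambda>x. S (T x)) (carr H)"
    using adjoint_pairD[OF T] by (auto simp: compose_def adj_eq[OF H T])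
  then have "op_abs H K T = restrict B (carr H)"
    by (simp add: op_abs_def op_sqrt_eq[OF H pb] B(3))
  then show "sqrt_abs H K T = restrict (fourth_root c T S) (carr H)"
    by (simp add: sqrt_abs_def op_sqrt_eq[OF H B(1)] eq A(3))
qed

lemma sqrt_abs_restrict:
  assumes H: "hilbert_module H" and T: "adjoint_pair H K T S"
  shows "sqrt_abs H K (restrict T (carr H)) = sqrt_abs H K T"
proof -
  have "adj H K (restrict T (carr H)) = adj H K T"
    by (simp add: adj_restrict[OF H T] adj_eq[OF H T])
  then have "compose (carr H) (adj H K (restrict T (carr H))) (restrict T (carr H)) = compose (carr H) (adj H K T) T"
    by (auto simp: compose_def)
  then show ?thesis by (simp add: sqrt_abs_def op_abs_def)
qed

text \<open>T intertwines S T with T S, and this passes through both square roots.\<close>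

lemma fourth_root_intertwine:
  assumes H: "hilbert_module H" and K: "hilbert_module K" and T: "adjoint_pair H K T S"
    and c: "c > 0" and bd: "\<And>x. x \<in> carr H \<Longrightarrow> norm (T x) \<le> c * norm x" and x: "x \<in> carr H"
  shows "T (fourth_root c T S x) = fourth_root c S T (T x)"
proof -
  have sq: "sqrt (c\<^sup>2) = c" using c by simp
  note cs = hilbert_module_cs[OF H] hilbert_module_cs[OF K]
  have bd': "\<And>y. y \<in> carr K \<Longrightarrow> norm (S y) \<le> c * norm y"
    using adjoint_norm_bound[OF H K T _ bd] c by simp
  note pH = pos_bound_adjoint_mult[OF H K T c bd]
    and pK = pos_bound_adjoint_mult[OF K H adjoint_pair_sym[OF H K T] c bd']
  show ?thesis
    unfolding fourth_root_def
    by (intro pos_sqrt_intertwine[OF cs(1) pos_bound_pos_sqrt[OF cs(1) pH, unfolded sq]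
          cs(2) pos_bound_pos_sqrt[OF cs(2) pK, unfolded sq] T _ x]
        pos_sqrt_intertwine[OF cs(1) pH cs(2) pK T]) auto
qed

subsection \<open>Resolvents and the polar factor\<close>

text \<open>G is the inverse of A + s. Expanding <(A + s) x, (A + s) x> into the positive terms <A
  x, A x>, 2 s <x, A x> and s^2 <x, x> gives injectivity and the bound on A G.\<close>

lemma pos_bound_resolvent:
  assumes H: "hilbert_module H" and A: "pos_bound H a A" and s: "s > 0"
  obtains G where "adjoint_pair H H G G" "\<And>y. y \<in> carr H \<Longrightarrow> A (G y) = y - s *\<^sub>R G y"
    "\<And>y. y \<in> carr H \<Longrightarrow> G (A y) = A (G y)" "\<And>y. y \<in> carr H \<Longrightarrow> norm (A (G y)) \<le> norm y"
proof -
  interpret hilbert_module H by fact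
  have a: "a > 0" and A_sa: "adjoint_pair H H A A"
    and le: "\<And>x. x \<in> carr H \<Longrightarrow> norm (a *\<^sub>R x - A x) \<le> a * norm x"
    using A by (auto simp: pos_bound_def)
  note D = adjoint_pairD[OF A_sa] and L = adjoint_pair_linear[OF H H A_sa]
  obtain B where B: "adjoint_pair H H B B" "\<And>x. x \<in> carr H \<Longrightarrow> ip H x (A x) = ip H (B x) (B x)"
    using pos_bound_sqrt_facts[OF H A] by metis
  have ip_eq: "ip H (A x + s *\<^sub>R x) (A x + s *\<^sub>R x) = ip H (A x) (A x) + (2 * s) *\<^sub>R ip H (B x) (B x) + (s * s) *\<^sub>R ip H x x"
    if x: "x \<in> carr H" for x
  proof -
    have in_carr: "A x \<in> carr H" "s *\<^sub>R x \<in> carr H" "A x + s *\<^sub>R x \<in> carr H" using x D(1) by auto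
    have "ip H (A x + s *\<^sub>R x) (A x + s *\<^sub>R x) = ip H (A x) (A x) + (s *\<^sub>R ip H x (A x) + s *\<^sub>R ip H x (A x)) + (s * s) *\<^sub>R ip H x x"
      unfolding ip_add[OF in_carr(3,1,2)] ip_add_left[OF in_carr(1,2,1)] ip_add_left[OF in_carr(1,2,2)]
        ip_scaleR[OF in_carr(1) x] ip_scaleR[OF in_carr(2) x] ip_scaleR_left[OF x in_carr(1)] ip_scaleR_left[OF x x] D(3)[OF x x]
      by (simp add: add.assoc)
    moreover have "(2 * s) *\<^sub>R q = s *\<^sub>R q + s *\<^sub>R q" for q :: 'a by (metis mult_2 scaleR_add_left)
    ultimately show ?thesis using B(2)[OF x] by simp
  qed
  have le1: "norm (A x) \<le> norm (A x + s *\<^sub>R x)" and le2: "norm (s *\<^sub>R x) \<le> norm (A x + s *\<^sub>R x)" if x: "x \<in> carr H" for x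
  proof -
    have p: "elt_pos ((2 * s) *\<^sub>R ip H (B x) (B x))" "elt_pos ((s * s) *\<^sub>R ip H x x)" "elt_pos (ip H (A x) (A x))"
      by (rule elt_pos_scaleR[OF elt_pos_ip_self] elt_pos_ip_self, (simp add: s x D(1) adjoint_pairD(1)[OF B(1)])+)+
    show "norm (A x) \<le> norm (A x + s *\<^sub>R x)"
      by (rule norm_le_if_ip_add[OF _ _ elt_pos_add[OF p(1,2)]]) (use x D(1) ip_eq[OF x] in \<open>auto simp: add.assoc\<close>)
    show "norm (s *\<^sub>R x) \<le> norm (A x + s *\<^sub>R x)"
      by (rule norm_le_if_ip_add[OF _ _ elt_pos_add[OF p(3,1)]])
        (use x D(1) ip_eq[OF x] in \<open>auto simp: ip_scaleR ip_scaleR_left add_ac\<close>)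
  qed
  have ex: "\<exists>x\<in>carr H. A x + s *\<^sub>R x = y" if y: "y \<in> carr H" for y
  proof -
    \<comment> \<open>The equation A x + s x = y is rewritten as (a + s) x = y + (a - A) x; the
      bound norm (a - A) <= a gives the contraction factor a / (a + s).\<close>
    define f where "f x = (1/(a + s)) *\<^sub>R (y + (a *\<^sub>R x - A x))" for x
    have "\<exists>!x\<in>carr H. f x = x"
    proof (rule Banach_fix)
      show "complete (carr H)" by (rule complete_carr)
      show "carr H \<noteq> {}" using y by auto
      show "0 \<le> a / (a + s)" "a / (a + s) < 1" using a s by auto
      show "f ` carr H \<subseteq> carr H" using y D by (auto simp: f_def)
      show "dist (f x) (f z) \<le> a / (a + s) * dist x z" if *: "x \<in> carr H" "z \<in> carr H" for x z
      proof -
        have "f x - f z = (1/(a + s)) *\<^sub>R (a *\<^sub>R (x - z) - A (x - z))"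
          using * by (simp add: f_def L algebra_simps)
        then have "dist (f x) (f z) = (1/(a + s)) * norm (a *\<^sub>R (x - z) - A (x - z))"
          using a s by (simp add: dist_norm)
        also have "\<dots> \<le> (1/(a + s)) * (a * norm (x - z))" using le[of "x - z"] * a s by (intro mult_left_mono) auto
        finally show ?thesis by (simp add: dist_norm)
      qed
    qed
    then obtain x where x: "x \<in> carr H" "f x = x" by blast
    have "(a + s) *\<^sub>R f x = y + (a *\<^sub>R x - A x)" using a s by (simp add: f_def)
    then have "A x + s *\<^sub>R x = y" unfolding x(2) by (simp add: algebra_simps)
    then show ?thesis using x by blast
  qed
  define G where "G y = (SOME x. x \<in> carr H \<and> A x + s *\<^sub>R x = y)" for y
  have G: "G y \<in> carr H" "A (G y) + s *\<^sub>R G y = y" if "y \<in> carr H" for y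
    using someI_ex[of "\<lambda>x. x \<in> carr H \<and> A x + s *\<^sub>R x = y"] ex[OF that] unfolding G_def by auto
  have inj: "x = z" if "x \<in> carr H" "z \<in> carr H" "A x + s *\<^sub>R x = A z + s *\<^sub>R z" for x z
  proof -
    have "A (x - z) + s *\<^sub>R (x - z) = 0" using that by (simp add: L algebra_simps)
    then have "norm (s *\<^sub>R (x - z)) \<le> 0" using le2[of "x - z"] that by simp
    then show ?thesis using s by (simp add: mult_le_0_iff)
  qed
  show ?thesis
  proof
    show "adjoint_pair H H G G"
      unfolding adjoint_pair_def
    proof (intro conjI ballI)
      fix y z assume *: "y \<in> carr H" "z \<in> carr H"
      have "ip H (G y) z = ip H (G y) (A (G z) + s *\<^sub>R G z)" using G * by simp
      also have "\<dots> = ip H (A (G y) + s *\<^sub>R G y) (G z)" using G(1) * D by (simp add: ip_simps)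
      finally show "ip H (G y) z = ip H y (G z)" using G * by simp
    qed (use G in auto)
    fix y assume y: "y \<in> carr H"
    show "A (G y) = y - s *\<^sub>R G y" using G(2)[OF y] by (simp add: algebra_simps)
    show "G (A y) = A (G y)"
    proof (rule inj)
      have "A (A (G y) + s *\<^sub>R G y) = A (A (G y)) + s *\<^sub>R A (G y)" using G(1) y D(1) by (simp add: L)
      then show "A (G (A y)) + s *\<^sub>R G (A y) = A (A (G y)) + s *\<^sub>R A (G y)"
        using G(2)[OF y] G(2)[OF D(1)[OF y]] by simp
    qed (use G y D in auto)
    show "norm (A (G y)) \<le> norm y" using le1[OF G(1)[OF y]] G(2)[OF y] by simp
  qed
qed

text \<open>For s = 1/(n+1) the resolvent identity gives A^2 G_n - A = - s A G_n, and A G_n is a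
  contraction: the convergence to A is uniform on the unit ball.\<close>

lemma pos_bound_resolvent_approx:
  assumes H: "hilbert_module H" and A: "pos_bound H a A"
  obtains G where "\<And>n. adjoint_pair H H (G n) (G n)"
    "\<And>n y. y \<in> carr H \<Longrightarrow> A (G n y) = y - (1 / real (Suc n)) *\<^sub>R G n y"
    "\<And>n y. y \<in> carr H \<Longrightarrow> G n (A y) = A (G n y)"
    "\<And>n y. y \<in> carr H \<Longrightarrow> norm (A (A (G n y)) - A y) \<le> norm y / real (Suc n)"
proof -
  interpret hilbert_module H by fact
  have A_sa: "adjoint_pair H H A A" using A by (auto simp: pos_bound_def)
  note D = adjoint_pairD[OF A_sa] and L = adjoint_pair_linear[OF H H A_sa]
  have "\<exists>G. adjoint_pair H H G G \<and> (\<forall>y\<in>carr H. A (G y) = y - (1 / real (Suc n)) *\<^sub>R G y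
      \<and> G (A y) = A (G y) \<and> norm (A (G y)) \<le> norm y)" for n
    using pos_bound_resolvent[OF H A, of "1 / real (Suc n)"] by (metis of_nat_0_less_iff zero_less_Suc zero_less_divide_1_iff)
  then obtain G where G: "\<And>n. adjoint_pair H H (G n) (G n)" "\<And>n y. y \<in> carr H \<Longrightarrow> A (G n y) = y - (1 / real (Suc n)) *\<^sub>R G n y"
    "\<And>n y. y \<in> carr H \<Longrightarrow> G n (A y) = A (G n y)" "\<And>n y. y \<in> carr H \<Longrightarrow> norm (A (G n y)) \<le> norm y"
    by metis
  show ?thesis
  proof (rule that[OF G(1-3)])
    fix n y assume y: "y \<in> carr H"
    have Gy: "G n y \<in> carr H" using adjoint_pairD(1)[OF G(1)] y by blast
    have "A (A (G n y)) = A y - (1 / real (Suc n)) *\<^sub>R A (G n y)"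
      by (subst G(2)[OF y]) (use y Gy in \<open>simp add: L\<close>)
    then have "norm (A (A (G n y)) - A y) = (1 / real (Suc n)) * norm (A (G n y))" by simp
    also have "\<dots> \<le> (1 / real (Suc n)) * norm y" using G(4)[OF y] by (intro mult_left_mono) auto
    finally show "norm (A (A (G n y)) - A y) \<le> norm y / real (Suc n)" by simp
  qed
qed

section \<open>Closures of ranges and the polar factor\<close>

lemma in_closure_LIMSEQ:
  fixes l :: "'a::metric_space"
  shows "\<lbrakk>\<And>n. f n \<in> X; f \<longlonglongrightarrow> l\<rbrakk> \<Longrightarrow> l \<in> closure X"
  unfolding closure_sequential by (intro exI[of _ f] conjI allI)

lemma in_closure_image: "\<lbrakk>y = f x; x \<in> X\<rbrakk> \<Longrightarrow> y \<in> closure (f ` X)"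
  using closure_subset by fastforce

lemma pos_bound_range_square:
  assumes H: "hilbert_module H" and A: "pos_bound H a A" and y: "y \<in> carr H"
  shows "A y \<in> closure ((\<lambda>x. A (A x)) ` carr H)"
proof -
  obtain G where G: "\<And>n. adjoint_pair H H (G n) (G n)"
    "\<And>n y. y \<in> carr H \<Longrightarrow> norm (A (A (G n y)) - A y) \<le> norm y / real (Suc n)"
    using pos_bound_resolvent_approx[OF H A] by metis
  have "(\<lambda>n. norm y / real (Suc n)) \<longlonglongrightarrow> 0" by (rule LIMSEQ_Suc[OF lim_const_over_n])
  then have "(\<lambda>n. A (A (G n y)) - A y) \<longlonglongrightarrow> 0"
    by (rule Lim_null_comparison[rotated]) (use G(2)[OF y] in auto)
  then have "(\<lambda>n. A (A (G n y))) \<longlonglongrightarrow> A y" by (rule LIM_zero_cancel)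
  then show ?thesis
    by (rule in_closure_LIMSEQ[rotated]) (use adjoint_pairD(1)[OF G(1)] y in blast)
qed

lemma closure_carr:
  assumes "hilbert_module H" "X \<subseteq> carr H"
  shows "closure X \<subseteq> carr H"
  using assms by (meson closure_minimal complete_imp_closed hilbert_module.complete_carr)

text \<open>Such a z is orthogonal to the range of S, since <z, S y> = <T z, y> = 0, and by
  continuity to itself. Most uniqueness arguments below rest on this.\<close>

lemma kernel_closure_range_adjoint:
  assumes H: "hilbert_module H" and K: "hilbert_module K" and T: "adjoint_pair H K T S"
    and z: "z \<in> closure (S ` carr K)" and 0: "T z = 0"
  shows "z = 0"
proof -
  interpret H: hilbert_module H by fact
  interpret K: hilbert_module K by fact
  note D = adjoint_pairD[OF T]
  have zH: "z \<in> carr H" using closure_carr[OF H, of "S ` carr K"] D z by auto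
  obtain w where w: "\<And>n. w n \<in> S ` carr K" "w \<longlonglongrightarrow> z" using z unfolding closure_sequential by blast
  have "ip H z (w n) = 0" for n
  proof -
    obtain y where y: "y \<in> carr K" "w n = S y" using w(1) by blast
    have "ip H z (S y) = ip K (T z) y" using D zH y by simp
    then show ?thesis using 0 y by simp
  qed
  moreover have "w n \<in> carr H" for n using w(1)[of n] D(2) by auto
  then have "(\<lambda>n. ip H z (w n)) \<longlonglongrightarrow> ip H z z"
    by (rule H.tendsto_ip_right[OF w(2) _ zH zH])
  ultimately have "ip H z z = 0" by (simp add: LIMSEQ_const_iff)
  then show ?thesis using H.ip_definite zH by blast
qed

lemma closure_range_diff:
  assumes H: "hilbert_module H" and K: "hilbert_module K" and T: "adjoint_pair H K T S"
    and "y \<in> closure (T ` carr H)" "z \<in> closure (T ` carr H)"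
  shows "y - z \<in> closure (T ` carr H)"
proof -
  interpret H: hilbert_module H by fact
  obtain v w where v: "\<And>n. v n \<in> T ` carr H" "v \<longlonglongrightarrow> y" and w: "\<And>n. w n \<in> T ` carr H" "w \<longlonglongrightarrow> z"
    using assms(4,5) unfolding closure_sequential by metis
  have in_range: "v n - w n \<in> T ` carr H" for n
  proof -
    obtain x x' where "x \<in> carr H" "x' \<in> carr H" "v n = T x" "w n = T x'" using v(1) w(1) by (metis imageE)
    then show ?thesis using adjoint_pair_linear(2)[OF H K T] by (metis H.carr_closed(6) image_eqI)
  qed
  show ?thesis by (rule in_closure_LIMSEQ[OF in_range tendsto_diff[OF v(2) w(2)]])
qed

lemma closure_range_mono: "x \<in> closure X \<Longrightarrow> X \<subseteq> closure Y \<Longrightarrow> x \<in> closure Y"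
  by (meson closure_closed closure_minimal closed_closure subsetD)

text \<open>V is the limit of G_n T and V' that of S G_n. Since S* S = T S = A^4, norm (S z) = norm
  (A^2 z), which carries the uniform Cauchy estimate for A^2 G_n over to S G_n; G_n T inherits it as
  the adjoint.\<close>

lemma polar_factor_exists:
  assumes H: "hilbert_module H" and K: "hilbert_module K" and T: "adjoint_pair H K T S"
    and A: "pos_bound K a A" and A4: "\<And>y. y \<in> carr K \<Longrightarrow> A (A (A (A y))) = T (S y)"
  obtains V V' where "adjoint_pair H K V V'" "\<And>x. x \<in> carr H \<Longrightarrow> A (V x) = T x"
    "\<And>x. x \<in> carr H \<Longrightarrow> V x \<in> closure (A ` carr K)"
    "\<And>y. y \<in> carr K \<Longrightarrow> V' y \<in> closure (S ` carr K)"
proof -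
  interpret H: hilbert_module H by fact
  interpret K: hilbert_module K by fact
  note hcs = H.cs_hilbert_module_axioms and kcs = K.cs_hilbert_module_axioms
  have A_sa: "adjoint_pair K K A A" using A by (simp add: pos_bound_def)
  note D = adjoint_pairD[OF T] and AD = adjoint_pairD[OF A_sa]
  note TL = adjoint_pair_linear[OF H K T] and AL = adjoint_pair_linear[OF K K A_sa]
  note S = adjoint_pair_sym[OF H K T]
  note SL = adjoint_pair_linear[OF K H S]
  have S_norm: "norm (S z) = norm (A (A z))" if z: "z \<in> carr K" for z
  proof -
    have "ip H (S z) (S z) = ip K z (T (S z))" using adjoint_pairD[OF S] z by simp
    also have "\<dots> = ip K (A (A z)) (A (A z))" using z AD by (simp flip: A4)
    finally show ?thesis using D AD z by (simp add: H.norm_ip K.norm_ip)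
  qed
  obtain G where G: "\<And>n. adjoint_pair K K (G n) (G n)"
    "\<And>n y. y \<in> carr K \<Longrightarrow> A (G n y) = y - (1 / real (Suc n)) *\<^sub>R G n y"
    "\<And>n y. y \<in> carr K \<Longrightarrow> G n (A y) = A (G n y)"
    "\<And>n y. y \<in> carr K \<Longrightarrow> norm (A (A (G n y)) - A y) \<le> norm y / real (Suc n)"
    using pos_bound_resolvent_approx[OF K A] by metis
  note GD = adjoint_pairD[OF G(1)]
  define e where "e n m = 1 / real (Suc n) + 1 / real (Suc m)" for n m
  have V'_diff: "norm (S (G n y) - S (G m y)) \<le> e n m * norm y" if y: "y \<in> carr K" for n m y
  proof -
    have "norm (S (G n y) - S (G m y)) = norm (A (A (G n y)) - A (A (G m y)))"
      using S_norm[of "G n y - G m y"] GD AD y by (simp add: SL AL)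
    also have "\<dots> \<le> norm (A (A (G n y)) - A y) + norm (A (A (G m y)) - A y)"
      using norm_triangle_ineq4[of "A (A (G n y)) - A y" "A (A (G m y)) - A y"] by simp
    also have "\<dots> \<le> e n m * norm y"
      using G(4)[OF y, of n] G(4)[OF y, of m] by (simp add: e_def distrib_right)
    finally show ?thesis .
  qed
  have V_diff: "norm (G n (T x) - G m (T x)) \<le> e n m * norm x" if x: "x \<in> carr H" for n m x
  proof -
    have pair: "adjoint_pair K H (\<lambda>y. S (G n y) - S (G m y)) (\<lambda>x. G n (T x) - G m (T x))"
      unfolding adjoint_pair_def using D GD adjoint_pairD(3)[OF S]
      by (auto simp: H.ip_simps K.ip_simps)
    have "0 \<le> e n m" by (simp add: e_def)
    from adjoint_norm_bound[OF K H pair this V'_diff x] show ?thesis .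
  qed
  have conv: "\<exists>l\<in>X. f \<longlonglongrightarrow> l"
    if "complete X" "\<And>n. f n \<in> X" "\<And>n m. norm (f n - f m) \<le> e n m * c" for f :: "nat \<Rightarrow> 'x::real_normed_vector" and c X
  proof -
    have c: "c \<ge> 0" using that(3)[of 0 0] norm_ge_zero[of "f 0 - f 0"] by (simp add: e_def)
    have "Cauchy f"
    proof (rule metric_CauchyI)
      fix r :: real assume r: "r > 0"
      have "(\<lambda>n. 2 * c / real (Suc n)) \<longlonglongrightarrow> 0" by (rule LIMSEQ_Suc[OF lim_const_over_n])
      then obtain N where N: "2 * c / real (Suc N) < r"
        using r by (metis (no_types, lifting) eventually_sequentially order_refl order_tendstoD(2))
      show "\<exists>M. \<forall>m\<ge>M. \<forall>n\<ge>M. dist (f m) (f n) < r"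
      proof (intro exI allI impI)
        fix m n assume "N \<le> m" "N \<le> n"
        then have "e m n \<le> 2 / real (Suc N)"
          using frac_le[of 1 1 "real (Suc N)" "real (Suc m)"] frac_le[of 1 1 "real (Suc N)" "real (Suc n)"]
          by (simp add: e_def)
        then have "e m n * c \<le> 2 / real (Suc N) * c" using c by (rule mult_right_mono)
        with that(3)[of m n] N show "dist (f m) (f n) < r" by (simp add: dist_norm)
      qed
    qed
    then show ?thesis using completeE[OF that(1)] that(2) by metis
  qed
  have "\<exists>l\<in>carr K. (\<lambda>n. G n (T x)) \<longlonglongrightarrow> l" if "x \<in> carr H" for x
    by (rule conv[OF K.complete_carr _ V_diff[OF that]]) (use that D GD in auto)
  then obtain V where V: "\<And>x. x \<in> carr H \<Longrightarrow> V x \<in> carr K \<and> (\<lambda>n. G n (T x)) \<longlonglongrightarrow> V x" by metis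
  have "\<exists>l\<in>carr H. (\<lambda>n. S (G n y)) \<longlonglongrightarrow> l" if "y \<in> carr K" for y
    by (rule conv[OF H.complete_carr _ V'_diff[OF that]]) (use that D GD in auto)
  then obtain V' where V': "\<And>y. y \<in> carr K \<Longrightarrow> V' y \<in> carr H \<and> (\<lambda>n. S (G n y)) \<longlonglongrightarrow> V' y" by metis
  have AV: "A (V x) = T x" if x: "x \<in> carr H" for x
  proof -
    obtain b where b: "\<And>y. y \<in> carr K \<Longrightarrow> norm (A y) \<le> b * norm y"
      using adjoint_pair_bounded[OF kcs kcs A_sa] by metis
    have lim: "(\<lambda>n. G n (T x) - V x) \<longlonglongrightarrow> 0" using V[OF x] by (simp add: LIM_zero)
    have A_le: "norm (A (G n (T x)) - A (V x)) \<le> b * norm (G n (T x) - V x)" for n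
      using b[of "G n (T x) - V x"] V[OF x] GD(1) D(1) x by (simp add: AL)
    have "(\<lambda>n. b * norm (G n (T x) - V x)) \<longlonglongrightarrow> 0"
      by (rule tendsto_mult_right_zero[OF tendsto_norm_zero[OF lim]])
    then have "(\<lambda>n. A (G n (T x)) - A (V x)) \<longlonglongrightarrow> 0"
      by (rule Lim_null_comparison[OF always_eventually, rotated]) (use A_le in blast)
    then have 1: "(\<lambda>n. A (G n (T x))) \<longlonglongrightarrow> A (V x)" by (rule LIM_zero_cancel)
    have "(\<lambda>n. 1 / real (Suc n)) \<longlonglongrightarrow> 0" by (rule LIMSEQ_Suc[OF lim_const_over_n])
    then have "(\<lambda>n. T x - (1 / real (Suc n)) *\<^sub>R G n (T x)) \<longlonglongrightarrow> T x - 0 *\<^sub>R V x"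
      using V[OF x] by (intro tendsto_intros) auto
    moreover have "A (G n (T x)) = T x - (1 / real (Suc n)) *\<^sub>R G n (T x)" for n using G(2) D x by blast
    ultimately have "(\<lambda>n. A (G n (T x))) \<longlonglongrightarrow> T x" by simp
    with 1 show ?thesis by (rule LIMSEQ_unique)
  qed
  show ?thesis
  proof
    show "adjoint_pair H K V V'"
      unfolding adjoint_pair_def
    proof (intro conjI ballI)
      fix x y assume *: "x \<in> carr H" "y \<in> carr K"
      have "(\<lambda>n. ip K (G n (T x)) y) \<longlonglongrightarrow> ip K (V x) y"
        using * V D GD by (intro K.tendsto_ip_left) auto
      moreover have "(\<lambda>n. ip H x (S (G n y))) \<longlonglongrightarrow> ip H x (V' y)"
        using * V' D GD by (intro H.tendsto_ip_right) auto
      moreover have "ip K (G n (T x)) y = ip H x (S (G n y))" for n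
        using * D GD by simp
      ultimately show "ip K (V x) y = ip H x (V' y)" using LIMSEQ_unique by auto
    qed (use V V' in auto)
    show "A (V x) = T x" if "x \<in> carr H" for x by (rule AV[OF that])
    show "V x \<in> closure (A ` carr K)" if x: "x \<in> carr H" for x
    proof -
      have "G n (T x) = A (G n (V x))" for n using AV[OF x] G(3) V[OF x] by metis
      then have "G n (T x) \<in> A ` carr K" for n using GD V[OF x] by blast
      then show ?thesis by (rule in_closure_LIMSEQ[of "\<lambda>n. G n (T x)"]) (use V[OF x] in blast)
    qed
    show "V' y \<in> closure (S ` carr K)" if y: "y \<in> carr K" for y
      by (rule in_closure_LIMSEQ[of "\<lambda>n. S (G n y)"]) (use V'[OF y] GD y in auto)
  qed
qed

text \<open>From V' A = S one gets A (V V') A = T S = A^4, so W = V V' - A^2 satisfies A W A = 0.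
  The values of W lie in the closure of the range of A, where A is injective: first W A = 0, then A
  W = 0 by selfadjointness, and finally W = 0.\<close>

lemma polar_square:
  assumes H: "hilbert_module H" and K: "hilbert_module K" and V: "adjoint_pair H K V V'"
    and T: "adjoint_pair H K T S" and A: "pos_bound K a A"
    and A4: "\<And>y. y \<in> carr K \<Longrightarrow> A (A (A (A y))) = T (S y)"
    and AV: "\<And>x. x \<in> carr H \<Longrightarrow> A (V x) = T x" and V_cl: "\<And>x. x \<in> carr H \<Longrightarrow> V x \<in> closure (A ` carr K)"
    and y: "y \<in> carr K"
  shows "A (A y) = V (V' y)" and "V' (A y) = S y"
proof -
  interpret H: hilbert_module H by fact
  interpret K: hilbert_module K by fact
  have A_sa: "adjoint_pair K K A A" using A by (simp add: pos_bound_def)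
  note D = adjoint_pairD[OF T] and VD = adjoint_pairD[OF V] and AD = adjoint_pairD[OF A_sa]
  note AL = adjoint_pair_linear[OF K K A_sa]
  have V'A: "V' (A y) = S y" if "y \<in> carr K" for y
  proof (rule H.ip_eqI)
    show "ip H x (V' (A y)) = ip H x (S y)" if "x \<in> carr H" for x
    proof -
      have "ip H x (V' (A y)) = ip K (A (V x)) y" using VD AD that \<open>y \<in> carr K\<close> by simp
      then show ?thesis using AV D that \<open>y \<in> carr K\<close> by simp
    qed
  qed (use VD AD D that in auto)
  show "V' (A y) = S y" by (rule V'A[OF y])
  define W where "W y = V (V' y) - A (A y)" for y
  have W: "adjoint_pair K K W W"
    using VD AD adjoint_pairD(3)[OF adjoint_pair_sym[OF H K V]] unfolding W_def adjoint_pair_def by (auto simp: K.ip_simps)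
  note WD = adjoint_pairD[OF W]
  have W_cl: "W y \<in> closure (A ` carr K)" if "y \<in> carr K" for y
    unfolding W_def
    by (rule closure_range_diff[OF K K A_sa V_cl in_closure_image[OF refl]]) (use VD AD that in auto)
  have "A (W (A y)) = 0" if "y \<in> carr K" for y
    using that VD AD D by (simp add: W_def AL V'A AV A4)
  then have WA: "W (A y) = 0" if "y \<in> carr K" for y
    using kernel_closure_range_adjoint[OF K K A_sa W_cl] AD that by blast
  have "A (W y) = 0"
  proof (rule K.ip_eqI_left)
    show "ip K (A (W y)) z = ip K 0 z" if "z \<in> carr K" for z
      using WA[OF that] WD AD y that by simp
  qed (use WD AD y in auto)
  then have "W y = 0" using kernel_closure_range_adjoint[OF K K A_sa W_cl] y by blast
  then show "A (A y) = V (V' y)" by (simp add: W_def)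
qed

lemma op_range_restrict [simp]: "op_range H (restrict T (carr H)) = T ` carr H"
  by (auto simp: op_range_def)

text \<open>Identifies \<open>reduced_solution\<close> from an explicit candidate. The values of two
  solutions differ by an element of the kernel of A in the closure of the range of A', hence by
  0.\<close>

lemma reduced_solution_eq:
  assumes H: "hilbert_module H" and K: "hilbert_module K" and E: "hilbert_module E"
    and A: "adjoint_pair H K A A'" and D: "adjoint_pair E H D D'"
    and C: "C = restrict (\<lambda>x. A (D x)) (carr E)" and cl: "\<And>x. x \<in> carr E \<Longrightarrow> D x \<in> closure (A' ` carr K)"
  shows "reduced_solution H K E (restrict A (carr H)) C = restrict D (carr E)"
  unfolding reduced_solution_def
proof (rule the_equality)
  have adj: "adj H K (restrict A (carr H)) = restrict A' (carr K)"
    by (rule adj_restrict[OF H A])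
  have rs: "is_reduced_solution H K E (restrict A (carr H)) C D1 \<longleftrightarrow>
    D1 \<in> adjointables E H \<and> compose (carr E) (restrict A (carr H)) D1 = C \<and> D1 ` carr E \<subseteq> closure (A' ` carr K)" for D1
    unfolding is_reduced_solution_def adj by (simp add: op_range_def[of E])
  note DD = adjoint_pairD[OF D]
  show "is_reduced_solution H K E (restrict A (carr H)) C (restrict D (carr E))"
    unfolding rs using restrict_adjointable[OF D] DD cl by (auto simp: C compose_def)
  fix D1 assume "is_reduced_solution H K E (restrict A (carr H)) C D1"
  then have D1: "D1 \<in> adjointables E H" "compose (carr E) (restrict A (carr H)) D1 = C"
    "\<And>x. x \<in> carr E \<Longrightarrow> D1 x \<in> closure (A' ` carr K)" unfolding rs by auto
  have D1': "D1 \<in> carr E \<rightarrow>\<^sub>E carr H" using D1(1) by (auto simp: adjointables_def)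
  show "D1 = restrict D (carr E)"
  proof (rule extensionalityI[where A = "carr E"])
    show "D1 \<in> extensional (carr E)" using D1' by (auto simp: PiE_def)
    fix x assume x: "x \<in> carr E"
    have in1: "D1 x \<in> carr H" using D1' x by auto
    have "A (D1 x) = A (D x)"
      using compose_eq[OF x, of "restrict A (carr H)" D1] in1 x unfolding D1(2) C by simp
    then have "A (D1 x - D x) = 0" using adjoint_pair_linear(2)[OF H K A in1 DD(1)[OF x]] by simp
    moreover have "D1 x - D x \<in> closure (A' ` carr K)"
      by (rule closure_range_diff[OF K H adjoint_pair_sym[OF H K A] D1(3)[OF x] cl[OF x]])
    ultimately have "D1 x - D x = 0" using kernel_closure_range_adjoint[OF H K A] by blast
    then show "D1 x = restrict D (carr E) x" using x by simp
  qed auto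
qed

text \<open>Only A V = T is constructed. As T A' = A T, the map A annihilates V A' - T, whose values
  lie in the closure of the range of A; hence V A' = T. The last four clauses are the range
  conditions of the four reduced solutions.\<close>

lemma polar_data:
  assumes H: "hilbert_module H" and K: "hilbert_module K" and T: "adjoint_pair H K T S"
  obtains A A' V V' where "adjoint_pair K K A A" "adjoint_pair H H A' A'" "adjoint_pair H K V V'"
    "sqrt_abs_adj H K (restrict T (carr H)) = restrict A (carr K)"
    "sqrt_abs H K (restrict T (carr H)) = restrict A' (carr H)"
    "V_op H K (restrict T (carr H)) = restrict V (carr H)"
    "\<And>x. x \<in> carr H \<Longrightarrow> A (V x) = T x" "\<And>x. x \<in> carr H \<Longrightarrow> V (A' x) = T x"
    "\<And>x. x \<in> carr H \<Longrightarrow> V x \<in> closure (A ` carr K)" "\<And>y. y \<in> carr K \<Longrightarrow> V' y \<in> closure (A' ` carr H)"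
    "\<And>y. y \<in> carr K \<Longrightarrow> A y \<in> closure (V ` carr H)" "\<And>x. x \<in> carr H \<Longrightarrow> A' x \<in> closure (V' ` carr K)"
proof -
  interpret H: hilbert_module H by fact
  interpret K: hilbert_module K by fact
  note S = adjoint_pair_sym[OF H K T]
  note D = adjoint_pairD[OF T]
  obtain c where c: "c > 0" "\<And>x. x \<in> carr H \<Longrightarrow> norm (T x) \<le> c * norm x"
    using adjoint_pair_bounded[OF H.cs_hilbert_module_axioms K.cs_hilbert_module_axioms T] by metis
  have c': "\<And>y. y \<in> carr K \<Longrightarrow> norm (S y) \<le> c * norm y"
    using adjoint_norm_bound[OF H K T _ c(2)] c(1) by simp
  define A where "A = fourth_root c S T"
  define A' where "A' = fourth_root c T S"
  have A: "pos_bound K (sqrt c) A" "\<And>y. y \<in> carr K \<Longrightarrow> A (A (A (A y))) = T (S y)" "sqrt_abs K H S = restrict A (carr K)"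
    unfolding A_def using pos_bound_fourth_root[OF K H S c(1) c'] fourth_root_power[OF K H S c(1) c'] sqrt_abs_eq[OF K H S c(1) c'] by auto
  have A': "pos_bound H (sqrt c) A'" "\<And>x. x \<in> carr H \<Longrightarrow> A' (A' (A' (A' x))) = S (T x)" "sqrt_abs H K T = restrict A' (carr H)"
    unfolding A'_def using pos_bound_fourth_root[OF H K T c] fourth_root_power[OF H K T c] sqrt_abs_eq[OF H K T c] by auto
  have A_sa: "adjoint_pair K K A A" and A'_sa: "adjoint_pair H H A' A'" using A(1) A'(1) by (auto simp: pos_bound_def)
  note AD = adjoint_pairD[OF A_sa] and A'D = adjoint_pairD[OF A'_sa]
  obtain V V' where V: "adjoint_pair H K V V'" "\<And>x. x \<in> carr H \<Longrightarrow> A (V x) = T x"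
    "\<And>x. x \<in> carr H \<Longrightarrow> V x \<in> closure (A ` carr K)" "\<And>y. y \<in> carr K \<Longrightarrow> V' y \<in> closure (S ` carr K)"
    using polar_factor_exists[OF H K T A(1,2)] by metis
  note V' = adjoint_pair_sym[OF H K V(1)]
  note VD = adjoint_pairD[OF V(1)]
  have VA': "V (A' x) = T x" if x: "x \<in> carr H" for x
  proof -
    have TA': "T (A' x) = A (T x)" unfolding A_def A'_def by (rule fourth_root_intertwine[OF H K T c x])
    have "V (A' x) - T x \<in> closure (A ` carr K)"
      by (rule closure_range_diff[OF K K A_sa V(3)]) (use x A'D(1) VD(1) closure_subset[of "A ` carr K"] V(2)[OF x] in \<open>auto simp flip: V(2)\<close>)
    moreover have "A (V (A' x) - T x) = 0"
      using x A'D VD D by (simp add: adjoint_pair_linear[OF K K A_sa] V(2) TA')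
    ultimately show ?thesis using kernel_closure_range_adjoint[OF K K A_sa] by fastforce
  qed
  have A'V': "A' (V' y) = S y" if y: "y \<in> carr K" for y
  proof (rule H.ip_eqI)
    show "ip H x (A' (V' y)) = ip H x (S y)" if x: "x \<in> carr H" for x
    proof -
      have "ip H x (A' (V' y)) = ip K (V (A' x)) y" using VD A'D x y by simp
      then show ?thesis using VA' D x y by simp
    qed
  qed (use VD A'D D y in auto)
  have V'_cl: "V' y \<in> closure (A' ` carr H)" if y: "y \<in> carr K" for y
  proof (rule closure_range_mono[OF V(4)[OF y]])
    show "S ` carr K \<subseteq> closure (A' ` carr H)"
    proof (intro subsetI, elim imageE)
      fix x z assume "x = S z" "z \<in> carr K"
      then have "x = A' (V' z)" "V' z \<in> carr H" using A'V' VD by auto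
      then show "x \<in> closure (A' ` carr H)" by (rule in_closure_image)
    qed
  qed
  \<comment> \<open>Two approximations: the range of A lies in the closure of that of A^2, and A^2 =
    V V' has its range in that of V.\<close>
  have A_cl: "A y \<in> closure (V ` carr H)" if y: "y \<in> carr K" for y
  proof (rule closure_range_mono[OF pos_bound_range_square[OF K A(1) y]])
    show "(\<lambda>y. A (A y)) ` carr K \<subseteq> closure (V ` carr H)"
    proof (intro subsetI, elim imageE)
      fix x z assume "x = A (A z)" "z \<in> carr K"
      then have "x = V (V' z)" "V' z \<in> carr H" using polar_square(1)[OF H K V(1) T A(1,2) V(2,3)] VD by auto
      then show "x \<in> closure (V ` carr H)" by (rule in_closure_image)
    qed
  qed
  have A'_cl: "A' x \<in> closure (V' ` carr K)" if x: "x \<in> carr H" for x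
  proof (rule closure_range_mono[OF pos_bound_range_square[OF H A'(1) x]])
    show "(\<lambda>x. A' (A' x)) ` carr H \<subseteq> closure (V' ` carr K)"
    proof (intro subsetI, elim imageE)
      fix x z assume "x = A' (A' z)" "z \<in> carr H"
      then have "x = V' (V z)" "V z \<in> carr K"
        using polar_square(1)[OF K H V' S A'(1,2) A'V' V'_cl] VD by auto
      then show "x \<in> closure (V' ` carr K)" by (rule in_closure_image)
    qed
  qed
  have adjT: "adj H K (restrict T (carr H)) = restrict S (carr K)"
    by (rule adj_restrict[OF H T])
  show ?thesis
  proof (rule that[OF A_sa A'_sa V(1)])
    show sa: "sqrt_abs_adj H K (restrict T (carr H)) = restrict A (carr K)"
      by (simp add: sqrt_abs_adj_def adjT sqrt_abs_restrict[OF K S] A(3))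
    show "sqrt_abs H K (restrict T (carr H)) = restrict A' (carr H)"
      by (simp add: sqrt_abs_restrict[OF H T] A'(3))
    show "V_op H K (restrict T (carr H)) = restrict V (carr H)"
      unfolding V_op_def sa
      by (rule reduced_solution_eq[OF K K H A_sa V(1)]) (use V in auto)
  qed (use V VA' V'_cl A_cl A'_cl in auto)
qed

subsection \<open>Orthogonally complemented submodules\<close>

lemma hilbert_module_sub:
  assumes H: "hilbert_module H" and M: "submodule H M" "complete M"
  shows "hilbert_module (sub_hmod H M)"
proof -
  interpret hilbert_module H by fact
  have sub: "x \<in> carr H" if "x \<in> M" for x using M(1) that by (auto simp: submodule_def)
  show ?thesis
  proof
    show "submodule (sub_hmod H M) (carr (sub_hmod H M))" using M(1) by (simp add: submodule_def)
    show "complete (carr (sub_hmod H M))" using M(2) by simp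
  next
    fix x a assume "x \<in> carr (sub_hmod H M)"
    then have x: "x \<in> carr H" using sub by simp
    fix b c
    show "act (sub_hmod H M) x (a + b) = act (sub_hmod H M) x a + act (sub_hmod H M) x b" using act_add_right[OF x] by simp
    show "act (sub_hmod H M) x (a * b) = act (sub_hmod H M) (act (sub_hmod H M) x a) b" using act_mult[OF x] by simp
    show "act (sub_hmod H M) (c *\<^sub>C x) a = c *\<^sub>C act (sub_hmod H M) x a" using act_scaleC_left[OF x] by simp
    show "act (sub_hmod H M) x (c *\<^sub>C a) = c *\<^sub>C act (sub_hmod H M) x a" using act_scaleC_right[OF x] by simp
    show "cstar_positive (ip (sub_hmod H M) x x)" using ip_positive[OF x] by simp
    show "ip (sub_hmod H M) x x = 0 \<Longrightarrow> x = 0" using ip_definite[OF x] by simp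
    show "norm x = sqrt (norm (ip (sub_hmod H M) x x))" using norm_ip[OF x] by simp
  qed (auto dest!: sub simp: act_add_left ip_add ip_scaleC ip_act ip_star)
qed

section \<open>Orthogonal complements and projections\<close>

lemma submodule_perp:
  assumes H: "hilbert_module H" and M: "M \<subseteq> carr H"
  shows "submodule H (perp H M)" and "complete (perp H M)"
proof -
  interpret hilbert_module H by fact
  have sub: "m \<in> carr H" if "m \<in> M" for m using M that by auto
  show "submodule H (perp H M)"
    unfolding submodule_def perp_def by (auto simp: sub ip_add ip_scaleC ip_act)
  show "complete (perp H M)"
  proof (rule completeI)
    fix f :: "nat \<Rightarrow> 'b" assume f: "\<forall>n. f n \<in> perp H M" "Cauchy f"
    then obtain l where l: "l \<in> carr H" "f \<longlonglongrightarrow> l"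
      using completeE[OF complete_carr, of f] by (auto simp: perp_def)
    have "ip H m l = 0" if m: "m \<in> M" for m
    proof -
      have "(\<lambda>n. ip H m (f n)) \<longlonglongrightarrow> ip H m l"
        by (rule tendsto_ip_right[OF l(2) _ l(1) sub[OF m]]) (use f in \<open>simp add: perp_def\<close>)
      moreover have "ip H m (f n) = 0" for n using f m by (simp add: perp_def)
      ultimately show ?thesis by (simp add: LIMSEQ_const_iff)
    qed
    then show "\<exists>l\<in>perp H M. f \<longlonglongrightarrow> l" using l by (auto simp: perp_def)
  qed
qed

locale complemented = hilbert_module H for H :: "('a::cstar_algebra, 'h::complex_normed_vector) hmod" +
  fixes M
  assumes compl: "orth_complemented H M"
begin

abbreviation "P \<equiv> proj H M"
abbreviation "P' \<equiv> proj_perp H M"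

lemma M_submodule: "submodule H M" and M_carr: "m \<in> M \<Longrightarrow> m \<in> carr H"
  using compl by (auto simp: orth_complemented_def submodule_def)

lemma perp_carr: "m \<in> perp H M \<Longrightarrow> m \<in> carr H"
  by (simp add: perp_def)

lemma hilbert_M: "hilbert_module (sub_hmod H M)"
proof (rule hilbert_module_sub[OF hilbert_module_axioms M_submodule])
  show "complete M"
    using compl M_carr by (intro complete_closed_subset[OF _ _ complete_carr]) (auto simp: orth_complemented_def)
qed

lemma hilbert_perp: "hilbert_module (sub_hmod H (perp H M))"
  by (rule hilbert_module_sub[OF hilbert_module_axioms submodule_perp[OF hilbert_module_axioms]]) (use M_carr in auto)

lemma perp_closed [simp, intro]:
  shows "0 \<in> M" "\<lbrakk>x \<in> M; y \<in> M\<rbrakk> \<Longrightarrow> x + y \<in> M" "\<lbrakk>x \<in> M; y \<in> M\<rbrakk> \<Longrightarrow> x - y \<in> M"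
    "0 \<in> perp H M" "\<lbrakk>x \<in> perp H M; y \<in> perp H M\<rbrakk> \<Longrightarrow> x + y \<in> perp H M"
    "\<lbrakk>x \<in> perp H M; y \<in> perp H M\<rbrakk> \<Longrightarrow> x - y \<in> perp H M"
  using hilbert_module.carr_closed[OF hilbert_M] hilbert_module.carr_closed[OF hilbert_perp] by auto

lemma ip_perp [simp]:
  assumes "m \<in> M" "z \<in> perp H M"
  shows "ip H m z = 0" "ip H z m = 0"
proof -
  show 0: "ip H m z = 0" using assms by (simp add: perp_def)
  show "ip H z m = 0" using ip_star[of m z] 0 M_carr perp_carr assms by simp
qed

lemma disjoint: "\<lbrakk>x \<in> M; x \<in> perp H M\<rbrakk> \<Longrightarrow> x = 0"
  using ip_perp(1)[of x x] ip_definite M_carr by blast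

lemma proj_eqI:
  assumes "m \<in> M" "z \<in> perp H M"
  shows "P (m + z) = m" "P' (m + z) = z"
proof -
  have x: "m + z \<in> carr H" using assms M_carr perp_carr by blast
  have "(THE m'. m' \<in> M \<and> m + z - m' \<in> perp H M) = m"
  proof (rule the_equality)
    fix m' assume m': "m' \<in> M \<and> m + z - m' \<in> perp H M"
    have "m + z - m' - z \<in> perp H M" using m' assms by blast
    moreover have "m - m' \<in> M" using m' assms by blast
    ultimately have "m - m' = 0" by (intro disjoint) (auto simp: algebra_simps)
    then show "m' = m" by simp
  qed (use assms in auto)
  then show "P (m + z) = m" using x by (simp add: proj_def)
  then show "P' (m + z) = z" using x by (simp add: proj_perp_def)
qed

lemma proj_id: "m \<in> M \<Longrightarrow> P m = m" "z \<in> perp H M \<Longrightarrow> P' z = z"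
    "z \<in> perp H M \<Longrightarrow> P z = 0" "m \<in> M \<Longrightarrow> P' m = 0"
  using proj_eqI[of m 0] proj_eqI[of 0 z] by auto

lemma proj_in:
  assumes "x \<in> carr H"
  shows "P x \<in> M" "P' x \<in> perp H M" "P x + P' x = x"
proof -
  obtain m z where "m \<in> M" "z \<in> perp H M" "x = m + z"
    using compl assms by (auto simp: orth_complemented_def set_sum_def)
  then show "P x \<in> M" "P' x \<in> perp H M" "P x + P' x = x" by (simp_all add: proj_eqI)
qed

lemma in_M_iff: "x \<in> carr H \<Longrightarrow> x \<in> M \<longleftrightarrow> P' x = 0"
  using proj_in[of x] proj_id(4)[of x] by (metis add.right_neutral)

lemma ip_proj:
  assumes "x \<in> carr H"
  shows "m \<in> M \<Longrightarrow> ip H (P x) m = ip H x m" "m \<in> M \<Longrightarrow> ip H m (P x) = ip H m x"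
    "z \<in> perp H M \<Longrightarrow> ip H (P' x) z = ip H x z" "z \<in> perp H M \<Longrightarrow> ip H z (P' x) = ip H z x"
proof -
  note p = proj_in[OF assms] and c = M_carr perp_carr
  have c': "P x \<in> carr H" "P' x \<in> carr H" using p c by auto
  show "m \<in> M \<Longrightarrow> ip H (P x) m = ip H x m"
    using ip_add_left[OF c' M_carr, of m] p by simp
  show "m \<in> M \<Longrightarrow> ip H m (P x) = ip H m x"
    using ip_add[OF M_carr c', of m] p by simp
  show "z \<in> perp H M \<Longrightarrow> ip H (P' x) z = ip H x z"
    using ip_add_left[OF c' perp_carr, of z] p by simp
  show "z \<in> perp H M \<Longrightarrow> ip H z (P' x) = ip H z x"
    using ip_add[OF perp_carr c', of z] p by simp
qed

lemma adjoint_pair_proj: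
  shows "adjoint_pair H (sub_hmod H M) P (\<lambda>x. x)" and "adjoint_pair H (sub_hmod H (perp H M)) P' (\<lambda>x. x)"
    and "adjoint_pair (sub_hmod H M) H (\<lambda>x. x) P" and "adjoint_pair (sub_hmod H (perp H M)) H (\<lambda>x. x) P'"
  unfolding adjoint_pair_def using M_carr perp_carr proj_in by (auto simp: ip_proj)

lemmas proj_linear = adjoint_pair_linear[OF hilbert_module_axioms hilbert_M adjoint_pair_proj(1)]
  and proj_perp_linear = adjoint_pair_linear[OF hilbert_module_axioms hilbert_perp adjoint_pair_proj(2)]

text \<open>\<open>adj_eq\<close> asks only the source to be a Hilbert module, so it applies
  although the external direct sum is not an instance of \<open>hilbert_module\<close>.\<close>

lemma decomp_unitary_adj_eq:
  "decomp_unitary_adj H M = restrict (\<lambda>(m, z). m + z) (M \<times> perp H M)"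
proof -
  have "adjoint_pair H (hmod_sum (sub_hmod H M) (sub_hmod H (perp H M))) (decomp_unitary H M) (\<lambda>(m, z). m + z)"
    unfolding adjoint_pair_def hmod_sum_def decomp_unitary_def
    using proj_in M_carr perp_carr by (auto simp: ip_proj ip_add)
  from adj_eq[OF hilbert_module_axioms this] show ?thesis
    by (simp add: decomp_unitary_adj_def hmod_sum_def)
qed

end

subsection \<open>The shorted operator of a complementable operator\<close>

lemma adjoint_unique:
  assumes H: "hilbert_module H" and "adjoint_pair H K T S" "adjoint_pair H K T' S'"
    and "\<And>x. x \<in> carr H \<Longrightarrow> T x = T' x" and y: "y \<in> carr K"
  shows "S y = S' y"
proof -
  interpret hilbert_module H by fact
  show ?thesis
  proof (rule ip_eqI)
    show "ip H z (S y) = ip H z (S' y)" if "z \<in> carr H" for z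
      using adjoint_pairD(3)[OF assms(2) that y] adjoint_pairD(3)[OF assms(3) that y] assms(4)[OF that] by simp
  qed (use y adjoint_pairD(2)[OF assms(2)] adjoint_pairD(2)[OF assms(3)] in auto)
qed

lemma bilateral_shorted_complementable:
  assumes H: "hilbert_module H" and K: "hilbert_module K" and M: "orth_complemented H M" and N: "orth_complemented K N"
    and T: "T \<in> adjointables H K" and Mr: "Mr \<in> adjointables H H" and Ml: "Ml \<in> adjointables K K"
    and Mr_perp: "\<And>x. x \<in> carr H \<Longrightarrow> proj_perp H M (Mr x) = Mr x"
    and Ml_perp: "\<And>y. y \<in> carr K \<Longrightarrow> Ml (proj_perp K N y) = Ml y"
    and T_Mr: "\<And>x. x \<in> carr H \<Longrightarrow> proj_perp K N (T (Mr x)) = proj_perp K N (T x)"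
    and Ml_T: "\<And>x. x \<in> carr H \<Longrightarrow> Ml (T (proj_perp H M x)) = T (proj_perp H M x)"
  shows "block_operator.bilateral_shorted H K M N T = restrict (\<lambda>x. T (proj H M x - Mr (proj H M x))) (carr H)"
proof -
  interpret H: complemented H M using H M by (simp add: complemented_def complemented_axioms_def)
  interpret K: complemented K N using K N by (simp add: complemented_def complemented_axioms_def)
  interpret block_operator H K M N T .
  note hM = H.hilbert_M and hM' = H.hilbert_perp and hN = K.hilbert_M and hN' = K.hilbert_perp
  define S where "S = adj H K T"
  have TS: "adjoint_pair H K T S" unfolding S_def by (rule adjoint_pair_adj[OF H T])
  note TL = adjoint_pair_linear[OF H K TS] and D = adjoint_pairD[OF TS]
  define t12 where "t12 x = K.P (T x)" for x
  define t where "t x = K.P' (T x)" for x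
  \<comment> \<open>The same formula appears twice because the maps are adjoints on different
    domains: \<open>N\<close> for \<open>t12'\<close> and the complement of \<open>N\<close> for
    \<open>t'\<close>.\<close>
  define t12' where "t12' y = H.P' (S y)" for y
  define t' where "t' y = H.P' (S y)" for y
  have t22: "adjoint_pair HM' KN' t t'" and t12: "adjoint_pair HM' KN t12 t12'"
    unfolding t_def t'_def t12_def t12'_def
    by (rule adjoint_pair_comp[OF adjoint_pair_comp[OF H.adjoint_pair_proj(4) TS] K.adjoint_pair_proj(2)]
        adjoint_pair_comp[OF adjoint_pair_comp[OF H.adjoint_pair_proj(4) TS] K.adjoint_pair_proj(1)])+
  obtain Mr' where Mr': "adjoint_pair H H Mr Mr'" using adjoint_pair_adj[OF H Mr] by blast
  obtain Ml' where Ml': "adjoint_pair K K Ml Ml'" using adjoint_pair_adj[OF K Ml] by blast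
  note MrD = adjoint_pairD[OF Mr']
  have Mr_in: "Mr x \<in> perp H M" if "x \<in> carr H" for x
    using H.proj_in(2)[of "Mr x"] Mr_perp[OF that] MrD(1)[OF that] by simp
  define X' where "X' z = H.P (Mr' z)" for z
  \<comment> \<open>The factor X of the overview is \<open>Mr\<close> itself on \<open>M\<close>,
    because its values already lie in the complement of \<open>M\<close>.\<close>
  have X: "adjoint_pair HM HM' Mr X'"
  proof -
    have "adjoint_pair HM HM' (\<lambda>x. H.P' (Mr x)) X'"
      unfolding X'_def by (rule adjoint_pair_comp[OF adjoint_pair_comp[OF H.adjoint_pair_proj(3) Mr'] H.adjoint_pair_proj(2)])
    then show ?thesis
      by (rule adjoint_pair_cong[THEN iffD1, rotated 2]) (use Mr_perp H.M_carr in auto)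
  qed
  define Y where "Y z = K.P (Ml z)" for z
  define Y' where "Y' n = K.P' (Ml' n)" for n
  have Y: "adjoint_pair KN' KN Y Y'"
    unfolding Y_def Y'_def
    by (rule adjoint_pair_comp[OF adjoint_pair_comp[OF K.adjoint_pair_proj(4) Ml'] K.adjoint_pair_proj(1)])
  note YN = adjoint_pair_sym[OF hN' hN Y]
  have tX: "t (Mr x) = t x" if "x \<in> carr H" for x using T_Mr[OF that] by (simp add: t_def)
  \<comment> \<open>On the complement of \<open>M\<close>, \<open>Ml\<close> reproduces T x and sees
    only its component outside \<open>N\<close>; compressing to \<open>N\<close> gives the
    factorization.\<close>
  have Yt: "Y (t x) = t12 x" if "x \<in> perp H M" for x
    using Ml_T[of x] Ml_perp[of "T x"] D(1)[of x] H.perp_carr[OF that] H.proj_id(2)[OF that]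
    by (simp add: Y_def t_def t12_def)
  have t'Y': "t' (Y' n) = t12' n" if "n \<in> N" for n
    by (rule adjoint_unique[OF hM' adjoint_pair_comp[OF t22 Y] t12]) (use Yt that in auto)
  have T21: "T21 = restrict t M" and T22: "T22 = restrict t (carr HM')" and T12: "T12 = restrict t12 (carr HM')"
    unfolding T21_def T22_def T12_def t_def t12_def by (auto simp: H.proj_id restrict_def fun_eq_iff)
  have T12a: "T12_adj = restrict t12' N"
    unfolding T12 using adj_restrict[OF hM' t12] by simp
  obtain A A' V V' where A: "adjoint_pair KN' KN' A A" and A': "adjoint_pair HM' HM' A' A'" and V: "adjoint_pair HM' KN' V V'"
    and sa: "sqrt_abs_adj HM' KN' (restrict t (carr HM')) = restrict A (carr KN')"
      "sqrt_abs HM' KN' (restrict t (carr HM')) = restrict A' (carr HM')"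
      "V_op HM' KN' (restrict t (carr HM')) = restrict V (carr HM')"
    and AV: "\<And>x. x \<in> carr HM' \<Longrightarrow> A (V x) = t x" and VA': "\<And>x. x \<in> carr HM' \<Longrightarrow> V (A' x) = t x"
    and cl: "\<And>x. x \<in> carr HM' \<Longrightarrow> V x \<in> closure (A ` carr KN')" "\<And>y. y \<in> carr KN' \<Longrightarrow> V' y \<in> closure (A' ` carr HM')"
      "\<And>y. y \<in> carr KN' \<Longrightarrow> A y \<in> closure (V ` carr HM')" "\<And>x. x \<in> carr HM' \<Longrightarrow> A' x \<in> closure (V' ` carr KN')"
    by (rule polar_data[OF hM' hN' t22]) (rule that)
  have A'V': "A' (V' y) = t' y" and V'A: "V' (A y) = t' y" if "y \<in> carr KN'" for y
    by (rule adjoint_unique[OF hM' adjoint_pair_comp[OF A' V] t22 VA' that], assumption)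
      (rule adjoint_unique[OF hM' adjoint_pair_comp[OF V A] t22 AV that], assumption)
  note VD = adjoint_pairD(1)[OF V] and AD = adjoint_pairD(1)[OF A] and A'D = adjoint_pairD(1)[OF A']
    and XD = adjoint_pairD(1)[OF X] and Y'D = adjoint_pairD(2)[OF Y]
    and V'D = adjoint_pairD(2)[OF V]
  have V': "adjoint_pair KN' HM' V' V" by (rule adjoint_pair_sym[OF hM' hN' V])
  have V22_adj: "adj HM' KN' (restrict V (carr HM')) = restrict V' (carr KN')"
    by (rule adj_restrict[OF hM' V])
  have E_pair: "adjoint_pair HM HM' (\<lambda>x. A' (Mr x)) (\<lambda>z. X' (A' z))" by (rule adjoint_pair_comp[OF X A'])
  have E: "E = restrict (\<lambda>x. A' (Mr x)) (carr HM)"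
    unfolding E_def T22 T21 sa
    by (rule reduced_solution_eq[OF hM' hN' hM V E_pair])
      (use XD H.M_carr VA' tX cl(4) in \<open>auto simp: fun_eq_iff\<close>)
  have F_pair: "adjoint_pair KN HM' (\<lambda>n. V' (Y' n)) (\<lambda>z. Y (V z))" by (rule adjoint_pair_comp[OF YN V'])
  have F: "F = restrict (\<lambda>n. V' (Y' n)) (carr KN)"
    unfolding F_def T12a unfolding T22 sa
    by (rule reduced_solution_eq[OF hM' hM' hN A' F_pair])
      (use Y'D A'V' t'Y' cl(2) in \<open>auto simp: fun_eq_iff\<close>)
  have Et_pair: "adjoint_pair HM KN' (\<lambda>x. V (Mr x)) (\<lambda>z. X' (V' z))" by (rule adjoint_pair_comp[OF X V])
  have Et: "E_tilde = restrict (\<lambda>x. V (Mr x)) (carr HM)"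
    unfolding E_tilde_def T22 T21 sa
    by (rule reduced_solution_eq[OF hN' hN' hM A Et_pair])
      (use XD H.M_carr AV tX cl(1) in \<open>auto simp: fun_eq_iff\<close>)
  have Ft_pair: "adjoint_pair KN KN' (\<lambda>n. A (Y' n)) (\<lambda>z. Y (A z))" by (rule adjoint_pair_comp[OF YN A])
  have Ft: "F_tilde = restrict (\<lambda>n. A (Y' n)) (carr KN)"
    unfolding F_tilde_def T12a unfolding T22 sa V22_adj
    by (rule reduced_solution_eq[OF hN' hM' hN V' Ft_pair])
      (use Y'D V'A t'Y' cl(3) in \<open>auto simp: fun_eq_iff\<close>)
  have adjF: "adj KN HM' F = restrict (\<lambda>z. Y (V z)) (carr HM')"
    unfolding F by (rule adj_restrict[OF hN F_pair])
  have adjFt: "adj KN KN' F_tilde = restrict (\<lambda>z. Y (A z)) (carr KN')"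
    unfolding Ft by (rule adj_restrict[OF hN Ft_pair])
  have schur: "schur_block m = T (m - Mr m)" and schur_in: "T (m - Mr m) \<in> N" if m: "m \<in> M" for m
  proof -
    have mH: "m \<in> carr H" using m H.M_carr by blast
    have X_in: "Mr m \<in> perp H M" "Mr m \<in> carr H" using Mr_in[OF mH] H.perp_carr by auto
    have Yt: "Y (t (Mr m)) = K.P (T (Mr m))" using Yt[OF X_in(1)] by (simp add: t12_def)
    have "(1/2) *\<^sub>R (adj KN HM' F (E m) + adj KN KN' F_tilde (E_tilde m)) = Y (t (Mr m))"
      unfolding adjF adjFt E Et using m X_in(1) A'D VD VA' AV by (simp flip: scaleR_2)
    then have "schur_block m = K.P (T m) - K.P (T (Mr m))"
      using m by (simp add: schur_block_def T11_def H.proj_id Yt)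
    also have "\<dots> = K.P (T (m - Mr m))" using mH X_in D(1) by (simp add: TL K.proj_linear)
    finally have 1: "schur_block m = K.P (T (m - Mr m))" .
    have in_K: "T (m - Mr m) \<in> carr K" using mH X_in D(1) by simp
    \<comment> \<open>The defining property of \<open>Mr\<close>: T m and T (Mr m) have the same
      component outside \<open>N\<close>. So no projection is left in the final formula.\<close>
    have "K.P' (T (m - Mr m)) = 0" using mH X_in D(1) T_Mr[OF mH] by (simp add: TL K.proj_perp_linear)
    then show 2: "T (m - Mr m) \<in> N" using K.in_M_iff[OF in_K] by simp
    show "schur_block m = T (m - Mr m)" using 1 K.proj_id(1)[OF 2] by simp
  qed
  show ?thesis
    unfolding bilateral_shorted_def
  proof (rule restrict_ext)
    fix x assume x: "x \<in> carr H"
    show "decomp_unitary_adj K N (block_matrix schur_block (\<lambda>_. 0) (\<lambda>_. 0) (\<lambda>_. 0) (decomp_unitary H M x))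
        = T (H.P x - Mr (H.P x))"
      using x H.proj_in[OF x] schur schur_in
      by (simp add: K.decomp_unitary_adj_eq block_matrix_def decomp_unitary_def)
  qed
qed

theorem corollary5p5:
  fixes H :: "('a::cstar_algebra, 'h::complex_normed_vector) hmod"
    and K :: "('a, 'k::complex_normed_vector) hmod"
    and M :: "'h set" and N :: "'k set" and T :: "'h \<Rightarrow> 'k"
  assumes "hilbert_module H" and "hilbert_module K"
    and "orth_complemented H M" and "orth_complemented K N"
    and "T \<in> adjointables H K"
    and "complementable H K M N T"
  shows "op_range H (block_operator.bilateral_shorted H K M N T) = op_range H T \<inter> N
    \<and> op_null H (block_operator.bilateral_shorted H K M N T) = set_sum (perp H M) (op_null H T)"
proof -
  note H = assms(1) and K = assms(2)
  interpret H: complemented H M using assms by (simp add: complemented_def complemented_axioms_def)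
  interpret K: complemented K N using assms by (simp add: complemented_def complemented_axioms_def)
  obtain Mr Ml where Mr: "Mr \<in> adjointables H H" and Ml: "Ml \<in> adjointables K K"
    and Mr_perp: "\<And>x. x \<in> carr H \<Longrightarrow> H.P' (Mr x) = Mr x"
    and Ml_perp: "\<And>y. y \<in> carr K \<Longrightarrow> Ml (K.P' y) = Ml y"
    and T_Mr: "\<And>x. x \<in> carr H \<Longrightarrow> K.P' (T (Mr x)) = K.P' (T x)"
    and Ml_T: "\<And>x. x \<in> carr H \<Longrightarrow> Ml (T (H.P' x)) = T (H.P' x)"
    using assms(6) unfolding complementable_def by blast
  define B where "B x = T (H.P x - Mr (H.P x))" for x
  have B: "block_operator.bilateral_shorted H K M N T = restrict B (carr H)"
    using bilateral_shorted_complementable[OF assms(1-5) Mr Ml Mr_perp Ml_perp T_Mr Ml_T] by (simp add: B_def[abs_def])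
  note TS = adjoint_pair_adj[OF H assms(5)] and MrS = adjoint_pair_adj[OF H Mr] and MlS = adjoint_pair_adj[OF K Ml]
  note D = adjoint_pairD(1)[OF TS] adjoint_pairD(1)[OF MrS] adjoint_pairD(1)[OF MlS]
  note TL = adjoint_pair_linear[OF H K TS]
  have Mr_in: "Mr x \<in> perp H M" if "x \<in> carr H" for x
    using H.proj_in(2)[of "Mr x"] Mr_perp[OF that] D(2)[OF that] by simp
  have Px: "H.P x \<in> carr H" "H.P' x \<in> carr H" "Mr (H.P x) \<in> perp H M" "Mr (H.P x) \<in> carr H" if "x \<in> carr H" for x
    using H.proj_in[OF that] H.M_carr H.perp_carr Mr_in by auto
  have B_range: "B x \<in> N" if x: "x \<in> carr H" for x
  proof -
    have "K.P' (B x) = 0" unfolding B_def using Px[OF x] D(1) T_Mr[OF Px(1)[OF x]] by (simp add: TL K.proj_perp_linear)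
    then show ?thesis using K.in_M_iff[of "B x"] D(1) Px[OF x] by (simp add: B_def)
  qed
  have T_eq_B: "T x = B x" if x: "x \<in> carr H" and Tx: "T x \<in> N" for x
  proof -
    \<comment> \<open>The difference of x and the argument of T in \<open>B x\<close>. Its image has
      no component outside \<open>N\<close>, and on the complement of \<open>M\<close> the map
      \<open>Ml\<close> recovers T z from that component, so T z = 0.\<close>
    let ?z = "H.P' x + Mr (H.P x)"
    have z: "?z \<in> perp H M" using H.proj_in(2)[OF x] Px(3)[OF x] by blast
    then have zH: "?z \<in> carr H" by (rule H.perp_carr)
    have "K.P' (T ?z) = K.P' (T (H.P' x)) + K.P' (T (H.P x))"
      using Px[OF x] D(1) T_Mr[OF Px(1)[OF x]] by (simp add: TL K.proj_perp_linear)
    also have "\<dots> = K.P' (T (H.P x + H.P' x))" using Px[OF x] D(1) by (simp add: TL K.proj_perp_linear)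
    also have "\<dots> = 0" using K.proj_id(4)[OF Tx] H.proj_in(3)[OF x] by simp
    finally have "Ml (T ?z) = 0"
      using Ml_perp[OF D(1)[OF zH]] adjoint_pair_linear(5)[OF K K MlS] by simp
    then have "T ?z = 0" using Ml_T[OF zH] H.proj_id(2)[OF z] by simp
    moreover have "x = ?z + (H.P x - Mr (H.P x))" using H.proj_in(3)[OF x] by (simp add: algebra_simps)
    ultimately show ?thesis
      unfolding B_def using zH Px[OF x] by (metis TL(1) H.carr_closed(6) add_0)
  qed
  have "op_range H (restrict B (carr H)) = op_range H T \<inter> N"
  proof (intro equalityI subsetI)
    fix y assume "y \<in> op_range H (restrict B (carr H))"
    then obtain x where x: "x \<in> carr H" "y = B x" by (auto simp: op_range_def)
    then have "y = T (H.P x - Mr (H.P x))" "H.P x - Mr (H.P x) \<in> carr H" using Px[OF x(1)] by (auto simp: B_def)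
    then show "y \<in> op_range H T \<inter> N" using B_range[OF x(1)] x(2) by (auto simp: op_range_def)
  next
    fix y assume "y \<in> op_range H T \<inter> N"
    then show "y \<in> op_range H (restrict B (carr H))" using T_eq_B by (auto simp: op_range_def)
  qed
  moreover have "op_null H (restrict B (carr H)) = set_sum (perp H M) (op_null H T)"
  proof (intro equalityI subsetI)
    fix x assume "x \<in> op_null H (restrict B (carr H))"
    then have x: "x \<in> carr H" "B x = 0" by (auto simp: op_null_def)
    \<comment> \<open>The same splitting as in the range part: the second summand lies in the null
      space of T precisely because B x = 0.\<close>
    have "x = (H.P' x + Mr (H.P x)) + (H.P x - Mr (H.P x))" using H.proj_in(3)[OF x(1)] by (simp add: algebra_simps)
    moreover have "H.P' x + Mr (H.P x) \<in> perp H M" using H.proj_in(2)[OF x(1)] Px(3)[OF x(1)] by blast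
    moreover have "H.P x - Mr (H.P x) \<in> op_null H T" using x(2) Px[OF x(1)] by (auto simp: op_null_def B_def)
    ultimately show "x \<in> set_sum (perp H M) (op_null H T)" unfolding set_sum_def by blast
  next
    fix x assume "x \<in> set_sum (perp H M) (op_null H T)"
    then obtain p z where pz: "p \<in> perp H M" "z \<in> carr H" "T z = 0" "x = p + z"
      by (auto simp: set_sum_def op_null_def)
    have p: "p \<in> carr H" by (rule H.perp_carr[OF pz(1)])
    \<comment> \<open>\<open>T_eq_B\<close> applies because T z = 0 belongs to \<open>N\<close>;
      adding p does not change B, which depends only on the projection to \<open>M\<close>.\<close>
    have "B z = 0" using T_eq_B[OF pz(2)] pz(3) by simp
    moreover have "H.P x = H.P z" using pz p by (simp add: H.proj_linear H.proj_id)
    ultimately have "B x = 0" by (simp add: B_def)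
    then show "x \<in> op_null H (restrict B (carr H))" using p pz by (simp add: op_null_def)
  qed
  ultimately show ?thesis unfolding B by blast
qed

end
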